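(* Let $(R,B,L)$ be a Hadamard system in $\mathbb{R}^d$, with associated measures $\mu_B,\mu_L$ and discrete sets $\Gamma(B),\Gamma(L)$. For $t\in\mathbb{R}^d$ set $$\sigma_{\Gamma(L)}^{(B)}(t)=\sum_{\gamma\in\Gamma(L)}|\widehat{\mu_B}(t+\gamma)|^2,\qquad \sigma_{\Gamma(B)}^{(L)}(t)=\sum_{\xi\in\Gamma(B)}|\widehat{\mu_L}(t+\xi)|^2 .$$ Then both functions are entire analytic in $t=(t_1,\dots,t_d)$, i.e., they have entire analytic extensions to $\mathbb{C}^d$. Further, $\sigma_{\Gamma(L)}^{(B)}(t)\le 1$ and $\sigma_{\Gamma(B)}^{(L)}(t)\le 1$ for all $t\in\mathbb{R}^d$.
   Context: Hadamard system $(R,B,L)$ in $\mathbb{R}^d$: $R$ is a $d\times d$ matrix with integer entries which is expansive (all eigenvalues $\lambda$ satisfy $|\lambda|>1$); $B,L\subset\mathbb{R}^d$ are finite sets with $0\in B$, $0\in L$, $\#B=\#L=N$; $R^k b\cdot l\in\mathbb{Z}$ for all $b\in B$, $l\in L$ and all integers $k\ge 0$; and the $N\times N$ matrix $\frac{1}{\sqrt N}\left(e^{2\pi i R^{-1}b\cdot l}\right)_{b\in B,\,l\in L}$ is unitary. Measures: for $b\in B$ let $\tau_b(x)=R^{-1}(x+b)$, and for $l\in L$ let $\sigma_l(x)=(R^T)^{-1}(x+l)$, $x\in\mathbb{R}^d$. $\mu_B$ is the unique Borel probability measure on $\mathbb{R}^d$ with $\mu_B=\frac1N\sum_{b\in B}\mu_B\circ\tau_b^{-1}$,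 and $\mu_L$ is the unique Borel probability measure with $\mu_L=\frac1N\sum_{l\in L}\mu_L\circ\sigma_l^{-1}$. Discrete sets: $\Gamma(B)=\{\sum_{k=0}^n R^k b_k : b_k\in B,\ n\ge 0\}$ and $\Gamma(L)=\{\sum_{k=0}^n (R^T)^k l_k : l_k\in L,\ n\ge 0\}$. Fourier transform: $\widehat{\mu}(t)=\int_{\mathbb{R}^d}e^{2\pi i t\cdot x}\,d\mu(x)$. *)

theory Defs
  imports "HOL-Probability.Probability"
begin

definition cmat_eigenvalue :: "complex ^ 'n ^ 'n \<Rightarrow> complex \<Rightarrow> bool" where
  "cmat_eigenvalue A c \<longleftrightarrow> (\<exists>v. v \<noteq> 0 \<and> A *v v = c *s v)"

definition expansive :: "real ^ 'n ^ 'n \<Rightarrow> bool" where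
  "expansive R \<longleftrightarrow> (\<forall>c. cmat_eigenvalue (map_matrix complex_of_real R) c \<longrightarrow> cmod c > 1)"

text \<open>A matrix with rows indexed by \<open>I\<close> and columns indexed by \<open>J\<close>: \<open>U U\<^sup>* = 1\<close> and \<open>U\<^sup>* U = 1\<close>.\<close>

definition unitary_on :: "'a set \<Rightarrow> 'b set \<Rightarrow> ('a \<Rightarrow> 'b \<Rightarrow> complex) \<Rightarrow> bool" where
  "unitary_on I J U \<longleftrightarrow>
     (\<forall>i\<in>I. \<forall>i'\<in>I. (\<Sum>j\<in>J. U i j * cnj (U i' j)) = (if i = i' then 1 else 0)) \<and>
     (\<forall>j\<in>J. \<forall>j'\<in>J. (\<Sum>i\<in>I. cnj (U i j) * U i j') = (if j = j' then 1 else 0))"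

text \<open>Multiplication on \<^typ>\<open>real ^ 'n ^ 'n\<close> is componentwise, so \<open>R ^ k\<close> would be the wrong
  power; matrix powers are written as iterates of \<^term>\<open>(*v) R\<close> throughout.\<close>

definition hadamard_system ::
    "real ^ 'n ^ 'n \<Rightarrow> (real ^ 'n) set \<Rightarrow> (real ^ 'n) set \<Rightarrow> bool" where
  "hadamard_system R B L \<longleftrightarrow>
     (\<forall>i j. R $ i $ j \<in> \<int>) \<and> expansive R \<and>
     finite B \<and> finite L \<and> 0 \<in> B \<and> 0 \<in> L \<and> card B = card L \<and>
     (\<forall>b\<in>B. \<forall>l\<in>L. \<forall>k. (((*v) R ^^ k) b) \<bullet> l \<in> \<int>) \<and>
     unitary_on B L (\<lambda>b l. exp (2 * complex_of_real pi * \<i> * complex_of_real ((matrix_inv R *v b) \<bullet> l))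
                             / complex_of_real (sqrt (real (card B))))"

text \<open>\<open>M\<close> is a Borel probability measure with \<open>M = 1/N * (\<Sum>d\<in>D. M \<circ> \<tau>\<^sub>d\<^sup>-\<^sup>1)\<close>, where
  \<open>\<tau>\<^sub>d x = A\<^sup>-\<^sup>1 (x + d)\<close> and \<open>N\<close> is the cardinality of \<open>D\<close>. For a Hadamard system \<open>(R, B, L)\<close>,
  \<open>\<mu>\<^sub>B\<close> is the unique such measure for \<open>R\<close> and \<open>B\<close>, and \<open>\<mu>\<^sub>L\<close> the unique one for
  \<open>transpose R\<close> and \<open>L\<close>.\<close>

definition invariant_measure ::
    "real ^ 'n ^ 'n \<Rightarrow> (real ^ 'n) set \<Rightarrow> (real ^ 'n) measure \<Rightarrow> bool" where
  "invariant_measure A D M \<longleftrightarrow>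
     prob_space M \<and> sets M = sets borel \<and>
     (\<forall>E\<in>sets borel. measure M E =
        (1 / real (card D)) * (\<Sum>d\<in>D. measure M ((\<lambda>x. matrix_inv A *v (x + d)) -` E)))"

text \<open>\<open>\<Gamma>(B)\<close> is \<open>digit_sums R B\<close>, and \<open>\<Gamma>(L)\<close> is \<open>digit_sums (transpose R) L\<close>.\<close>

definition digit_sums :: "real ^ 'n ^ 'n \<Rightarrow> (real ^ 'n) set \<Rightarrow> (real ^ 'n) set" where
  "digit_sums A D = {(\<Sum>k\<le>n. ((*v) A ^^ k) (c k)) | c n. \<forall>k\<le>n. c k \<in> D}"

definition fourier :: "(real ^ 'n) measure \<Rightarrow> real ^ 'n \<Rightarrow> complex" where
  "fourier M t = (\<integral>x. exp (2 * complex_of_real pi * \<i> * complex_of_real (t \<bullet> x)) \<partial>M)"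

text \<open>\<^const>\<open>infsum\<close> is 0 for a divergent sum, so bounds on \<open>spectral_sum\<close> are
  only meaningful together with summability.\<close>

definition spectral_sum :: "(real ^ 'n) measure \<Rightarrow> (real ^ 'n) set \<Rightarrow> real ^ 'n \<Rightarrow> real" where
  "spectral_sum M \<Gamma> t = (\<Sum>\<^sub>\<infinity>\<gamma>\<in>\<Gamma>. (cmod (fourier M (t + \<gamma>)))\<^sup>2)"

text \<open>Holomorphic on all of \<open>\<complex>\<^sup>d\<close>: at every point there is a complex-linear derivative.\<close>

definition entire :: "(complex ^ 'n \<Rightarrow> complex) \<Rightarrow> bool" where
  "entire F \<longleftrightarrow>
     (\<forall>z. \<exists>D. (F has_derivative D) (at z) \<and> (\<forall>c v. D (c *s v) = c * D v))"

definition has_entire_extension :: "(real ^ 'n \<Rightarrow> real) \<Rightarrow> bool" where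
  "has_entire_extension f \<longleftrightarrow>
     (\<exists>F. entire F \<and> (\<forall>t. F (\<chi> i. complex_of_real (t $ i)) = complex_of_real (f t)))"

end

theory Submission
  imports Defs "HOL-Computational_Algebra.Fundamental_Theorem_Algebra"
begin

text \<open>The exponentials with frequencies in \<open>\<Gamma>(L)\<close> are orthonormal in \<open>L\<^sup>2(\<mu>\<^sub>B)\<close>: the Fourier transform
  of \<open>\<mu>\<^sub>B\<close> satisfies a refinement equation whose mask vanishes at differences of distinct digits, by
  unitarity of the Hadamard matrix (\<open>hadamard_system_orthogonal\<close>). The values
  of the Fourier transform at the points \<open>t + \<gamma>\<close> are the coefficients of a character with respect to this family, so
  Bessel's inequality (\<open>bessel_inequality\<close>) gives summability and the bound 1.

  For the analytic extension, the squared modulus of such a value is written as the product of the integrals of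
  \<open>exp (2 \<pi> i (t + \<gamma>) \<cdot> x)\<close> and \<open>exp (- 2 \<pi> i (t + \<gamma>) \<cdot> x)\<close>, which makes sense for complex \<open>t\<close>
  because \<open>\<mu>\<^sub>B\<close> has bounded support (\<open>invariant_measure_bounded_support\<close>). By Bessel's inequality each factor
  is an element of \<open>\<ell>\<^sup>2(\<Gamma>(L))\<close>, and it depends on \<open>t\<close> in a complex differentiable way because the
  exponential function does so uniformly on bounded sets (\<open>exp_cdot_bounds\<close>). Hence the sum, a bounded
  bilinear expression in the two factors, is complex differentiable (\<open>complex_derivative_infsum_mult\<close>).

  Bounded support rests on the fact that the powers of the inverse of an expansive matrix tend to 0
  (\<open>expansive_inverse_powers_tendsto_0\<close>). The statement for \<open>\<mu>\<^sub>L\<close> follows because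
  \<open>(R\<^sup>T, L, B)\<close> is again a Hadamard system (\<open>hadamard_system_transpose\<close>).\<close>

section \<open>Powers of the inverse of an expansive matrix\<close>

text \<open>The vector \<open>p(A) v\<close>, evaluated by Horner's scheme.\<close>

definition poly_act :: "complex poly \<Rightarrow> complex ^ 'n ^ 'n \<Rightarrow> complex ^ 'n \<Rightarrow> complex ^ 'n" where
  "poly_act p A v = fold_coeffs (\<lambda>a w. a *s v + A *v w) p 0"

lemma poly_act_0 [simp]: "poly_act 0 A v = 0"
  by (simp add: poly_act_def)

lemma poly_act_pCons [simp]: "poly_act (pCons a p) A v = a *s v + A *v poly_act p A v"
  by (cases "p = 0 \<and> a = 0") (auto simp: poly_act_def)

lemma poly_act_smult: "poly_act (smult c p) A v = c *s poly_act p A v"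
  by (induction p)
     (auto simp: vector_scalar_commute vector_add_ldistrib vector_smult_assoc)

lemma poly_act_add: "poly_act (p + q) A v = poly_act p A v + poly_act q A v"
  by (induction p q rule: poly_induct2)
     (auto simp: matrix_vector_right_distrib vector_sadd_rdistrib algebra_simps)

lemma poly_act_sum: "poly_act (\<Sum>i\<in>I. f i) A v = (\<Sum>i\<in>I. poly_act (f i) A v)"
  by (induction I rule: infinite_finite_induct) (auto simp: poly_act_add)

lemma poly_act_monom: "poly_act (monom c i) A v = c *s ((*v) A ^^ i) v"
  by (induction i) (auto simp: monom_Suc monom_0 vector_scalar_commute)

lemma poly_act_linear_factor:
  "poly_act ([:- c, 1:] * q) A v = A *v poly_act q A v - c *s poly_act q A v"
proof -
  have "[:- c, 1:] * q = pCons 0 q + smult (- c) q" by simp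
  then show ?thesis
    by (simp only: poly_act_add poly_act_smult poly_act_pCons) (simp add: vector_smult_lneg)
qed

lemma poly_act_diff_arg: "poly_act p A (u - w) = poly_act p A u - poly_act p A w"
  by (induction p) (simp_all add: vector_ssub_ldistrib matrix_vector_mult_diff_distrib)

lemma poly_act_scale_arg: "poly_act p A (c *s u) = c *s poly_act p A u"
  by (induction p) (auto simp: vector_scalar_commute vector_add_ldistrib vector_smult_assoc mult.commute)

lemma poly_act_mult_arg: "poly_act p A (A *v u) = A *v poly_act p A u"
  by (induction p) (auto simp: vector_scalar_commute matrix_vector_right_distrib)

text \<open>In dimension \<open>d\<close> the vectors \<open>A\<^sup>i v\<close>, \<open>i \<le> 2d\<close>, satisfy a nontrivial linear relation over the reals.\<close>

lemma ex_annihilating_poly: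
  fixes A :: "complex ^ 'n ^ 'n"
  shows "\<exists>p. p \<noteq> 0 \<and> poly_act p A v = 0"
proof -
  define f where "f i = ((*v) A ^^ i) v" for i :: nat
  define m where "m = DIM(complex ^ 'n)"
  show ?thesis
  proof (cases "inj_on f {..m}")
    case True
    have "dependent (f ` {..m})"
      by (rule dependent_biggerset) (simp add: card_image[OF True], simp add: m_def)
    then obtain u where u: "\<exists>w\<in>f ` {..m}. u w \<noteq> 0" "(\<Sum>w\<in>f ` {..m}. u w *\<^sub>R w) = 0"
      by (auto simp: dependent_finite)
    define p where "p = (\<Sum>i\<le>m. monom (complex_of_real (u (f i))) i)"
    have "poly_act p A v = (\<Sum>i\<le>m. u (f i) *\<^sub>R f i)"
      by (auto simp: p_def poly_act_sum poly_act_monom f_def vec_eq_iff scaleR_conv_of_real[where 'a=complex])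
    also have "\<dots> = 0"
      using u(2) by (simp add: sum.reindex[OF True])
    finally have "poly_act p A v = 0" .
    moreover obtain j where j: "j \<le> m" "u (f j) \<noteq> 0"
      using u(1) by auto
    have "coeff p j = u (f j)"
      using j(1) by (simp add: p_def coeff_sum sum.delta)
    then have "p \<noteq> 0" using j(2) by auto
    ultimately show ?thesis by blast
  next
    case False
    then obtain i j where ij: "i \<noteq> j" "f i = f j" by (auto simp: inj_on_def)
    have "coeff (monom 1 i - monom 1 j :: complex poly) i = 1"
      using ij by simp
    then have "monom 1 i - monom 1 j \<noteq> (0 :: complex poly)"
      by (metis coeff_0 zero_neq_one)
    moreover have "poly_act (monom 1 i + smult (- 1) (monom 1 j)) A v = 0"
      using ij by (simp only: poly_act_add poly_act_smult poly_act_monom)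
        (simp add: f_def vector_smult_lneg)
    ultimately show ?thesis
      by (intro exI[of _ "monom 1 i - monom 1 j"])
        (simp add: diff_conv_add_uminus del: add_uminus_conv_diff)
  qed
qed

lemma perturbed_geometric_tendsto_0:
  fixes u w :: "nat \<Rightarrow> 'a::real_normed_vector"
  assumes c: "0 \<le> c" "c < 1" and w: "w \<longlonglongrightarrow> 0"
    and step: "\<And>k. norm (u (Suc k)) \<le> c * norm (u k) + norm (w k)"
  shows "u \<longlonglongrightarrow> 0"
proof (rule LIMSEQ_I)
  fix e :: real assume e: "e > 0"
  define e' where "e' = e * (1 - c) / 2"
  have "e' > 0" using e c by (simp add: e'_def)
  then obtain K where K: "\<And>k. k \<ge> K \<Longrightarrow> norm (w k) < e'"
    using LIMSEQ_D[OF w] by auto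
  have bd: "norm (u (K + n)) \<le> c ^ n * norm (u K) + e / 2" for n
  proof (induction n)
    case 0 then show ?case using e by simp
  next
    case (Suc n)
    have "norm (u (K + Suc n)) \<le> c * norm (u (K + n)) + norm (w (K + n))"
      using step[of "K + n"] by simp
    also have "\<dots> \<le> c * (c ^ n * norm (u K) + e / 2) + e'"
      using Suc c(1) K[of "K + n"] by (intro add_mono mult_left_mono) auto
    also have "\<dots> = c ^ Suc n * norm (u K) + e / 2"
      by (simp add: e'_def field_simps)
    finally show ?case .
  qed
  have "(\<lambda>n. c ^ n * norm (u K)) \<longlonglongrightarrow> 0"
    using c by (intro tendsto_mult_left_zero LIMSEQ_realpow_zero) auto
  then have "\<forall>\<^sub>F n in sequentially. c ^ n * norm (u K) < e / 2"
    using e by (intro order_tendstoD) auto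
  then obtain J where J: "\<And>n. n \<ge> J \<Longrightarrow> c ^ n * norm (u K) < e / 2"
    by (auto simp: eventually_sequentially)
  show "\<exists>no. \<forall>n\<ge>no. norm (u n - 0) < e"
  proof (intro exI allI impI)
    fix n assume n: "n \<ge> K + J"
    have "norm (u (K + (n - K))) < e"
      using bd[of "n - K"] J[of "n - K"] n by linarith
    then show "norm (u n - 0) < e" using n by simp
  qed
qed

text \<open>Induction on the degree of a polynomial annihilating \<open>v\<close>. A root \<open>c\<close> that is not an eigenvalue
  can be cancelled. If the root \<open>c\<close> is an eigenvalue, then \<open>w = A v - c v\<close> is annihilated by a polynomial
  of smaller degree, and \<open>A (A\<^sup>k v) = c A\<^sup>k v + A\<^sup>k w\<close> with \<open>|c| < 1\<close> and \<open>A\<^sup>k w\<close> tending to 0.\<close>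

lemma matrix_powers_tendsto_0:
  fixes A :: "complex ^ 'n ^ 'n"
  assumes ev: "\<And>c. cmat_eigenvalue A c \<Longrightarrow> cmod c < 1"
  shows "(\<lambda>k. ((*v) A ^^ k) v) \<longlonglongrightarrow> 0"
proof -
  have "(\<lambda>k. ((*v) A ^^ k) v) \<longlonglongrightarrow> 0" if "p \<noteq> 0" "poly_act p A v = 0" for p v
    using that
  proof (induction "degree p" arbitrary: p v rule: less_induct)
    case (less p)
    show ?case
    proof (cases "degree p = 0")
      case True
      then obtain a where "p = [:a:]" by (auto elim: degree_eq_zeroE)
      with less.prems have "a \<noteq> 0" "a *s v = 0" by auto
      then have "v = 0" by (simp add: vector_mul_eq_0)
      moreover have "((*v) A ^^ k) 0 = 0" for k by (induction k) auto
      ultimately show ?thesis by simp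
    next
      case False
      then have "\<not> constant (poly p)" by (simp add: constant_degree)
      then obtain c where "poly p c = 0" using fundamental_theorem_of_algebra by blast
      then obtain q where q: "p = [:- c, 1:] * q" by (auto simp: poly_eq_0_iff_dvd)
      have q0: "q \<noteq> 0" using less.prems q by auto
      have deg: "degree q < degree p"
        unfolding q using q0 by (subst degree_mult_eq) auto
      have ann: "A *v poly_act q A v - c *s poly_act q A v = 0"
        using less.prems(2) unfolding q poly_act_linear_factor .
      show ?thesis
      proof (cases "cmat_eigenvalue A c")
        case False
        then have "poly_act q A v = 0"
          using ann unfolding cmat_eigenvalue_def by (metis eq_iff_diff_eq_0)
        then show ?thesis using less.hyps deg q0 by blast
      next
        case True
        \<comment> \<open>By \<open>ann\<close>, the cofactor \<open>q\<close> annihilates \<open>w\<close>.\<close>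
        define w where "w = A *v v - c *s v"
        have "poly_act q A w = 0"
          unfolding w_def using ann by (simp add: poly_act_diff_arg poly_act_scale_arg poly_act_mult_arg)
        then have lim: "(\<lambda>k. ((*v) A ^^ k) w) \<longlonglongrightarrow> 0"
          using less.hyps deg q0 by blast
        have rec: "((*v) A ^^ k) (A *v v) = c *s ((*v) A ^^ k) v + ((*v) A ^^ k) w" for k
        proof (induction k)
          case 0 then show ?case by (simp add: w_def)
        next
          case (Suc k) then show ?case
            by (simp add: matrix_vector_right_distrib vector_scalar_commute)
        qed
        have nrm: "norm (c *s x) = cmod c * norm x" for x :: "complex ^ 'n"
          by (simp add: norm_vec_def L2_set_def norm_mult power_mult_distrib
              real_sqrt_mult flip: sum_distrib_left)
        show ?thesis
        proof (rule perturbed_geometric_tendsto_0[OF _ ev[OF True] lim])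
          fix k
          have "((*v) A ^^ Suc k) v = c *s ((*v) A ^^ k) v + ((*v) A ^^ k) w"
            using rec by (simp add: funpow_swap1)
          then show "norm (((*v) A ^^ Suc k) v)
              \<le> cmod c * norm (((*v) A ^^ k) v) + norm (((*v) A ^^ k) w)"
            by (metis nrm norm_triangle_ineq)
        qed simp
      qed
    qed
  qed
  then show ?thesis using ex_annihilating_poly by blast
qed

text \<open>The real vectors inside the complex ones.\<close>

definition cvec :: "real ^ 'n \<Rightarrow> complex ^ 'n" where
  "cvec x = (\<chi> i. complex_of_real (x $ i))"

lemma cvec_mult: "map_matrix complex_of_real A *v cvec x = cvec (A *v x)"
  by (simp add: vec_eq_iff cvec_def matrix_vector_mult_def)

lemma map_matrix_of_real_mult:
  "map_matrix complex_of_real A ** map_matrix complex_of_real B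
     = map_matrix complex_of_real (A ** B)"
  by (simp add: vec_eq_iff matrix_matrix_mult_def)

lemma map_matrix_of_real_mat_1: "map_matrix complex_of_real (mat 1) = mat 1"
  by (simp add: vec_eq_iff mat_def)

lemma cvec_eq_0_iff: "cvec x = 0 \<longleftrightarrow> x = 0"
  by (simp add: vec_eq_iff cvec_def)

lemma norm_cvec: "norm (cvec x) = norm x"
  by (simp add: norm_vec_def cvec_def)

lemma expansive_invertible:
  fixes A :: "real ^ 'n ^ 'n"
  assumes "expansive A"
  shows "invertible A"
proof -
  have "x = 0" if "A *v x = 0" for x
  proof (rule ccontr)
    assume "x \<noteq> 0"
    then have "cmat_eigenvalue (map_matrix complex_of_real A) 0"
      unfolding cmat_eigenvalue_def using that
      by (intro exI[of _ "cvec x"]) (simp add: cvec_mult cvec_eq_0_iff)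
    then show False using assms by (force simp: expansive_def)
  qed
  then show ?thesis
    by (simp add: invertible_left_inverse matrix_left_invertible_ker)
qed

lemma matrix_inv_right: "invertible A \<Longrightarrow> A ** matrix_inv A = mat 1"
  for A :: "real ^ 'n ^ 'n"
  unfolding invertible_def matrix_inv_def by (metis (mono_tags, lifting) someI_ex)

lemma expansive_inverse_powers_tendsto_0:
  fixes A :: "real ^ 'n ^ 'n"
  assumes "expansive A"
  shows "(\<lambda>k. ((*v) (matrix_inv A) ^^ k) v) \<longlonglongrightarrow> 0"
proof -
  define T where "T = map_matrix complex_of_real (matrix_inv A)"
  have inv: "map_matrix complex_of_real A ** T = mat 1"
    unfolding T_def map_matrix_of_real_mult
    by (simp add: matrix_inv_right expansive_invertible assms map_matrix_of_real_mat_1)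
  have "cmod c < 1" if "cmat_eigenvalue T c" for c
  proof (cases "c = 0")
    case False
    from that obtain u where u: "u \<noteq> 0" "T *v u = c *s u"
      by (auto simp: cmat_eigenvalue_def)
    have "u = map_matrix complex_of_real A *v (T *v u)"
      by (simp add: matrix_vector_mul_assoc inv)
    then have "u = c *s (map_matrix complex_of_real A *v u)"
      by (simp add: u vector_scalar_commute)
    then have "(1 / c) *s u = map_matrix complex_of_real A *v u"
      using False by (metis divide_self_if mult.commute mult_1 times_divide_eq_left vector_smult_assoc vector_smult_lid)
    then have "cmat_eigenvalue (map_matrix complex_of_real A) (1 / c)"
      using u(1) by (auto simp: cmat_eigenvalue_def)
    then have "cmod (1 / c) > 1" using assms by (auto simp: expansive_def)
    then show ?thesis using False by (simp add: norm_divide field_simps)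
  qed simp
  then have "(\<lambda>k. ((*v) T ^^ k) (cvec v)) \<longlonglongrightarrow> 0"
    by (rule matrix_powers_tendsto_0)
  moreover have "((*v) T ^^ k) (cvec v) = cvec (((*v) (matrix_inv A) ^^ k) v)" for k
    by (induction k) (simp_all add: T_def cvec_mult)
  ultimately have "(\<lambda>k. norm (cvec (((*v) (matrix_inv A) ^^ k) v))) \<longlonglongrightarrow> 0"
    by (simp add: tendsto_norm_zero)
  then show ?thesis
    by (simp add: norm_cvec tendsto_norm_zero_iff)
qed

lemma linear_funpow:
  fixes T :: "'a::real_vector \<Rightarrow> 'a"
  shows "linear T \<Longrightarrow> linear (T ^^ k)"
  by (induction k) (simp_all add: linear_iff)

lemma ex_power_norm_le_half:
  fixes T :: "'a::euclidean_space \<Rightarrow> 'a"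
  assumes "linear T" and lim: "\<And>v. (\<lambda>k. (T ^^ k) v) \<longlonglongrightarrow> 0"
  shows "\<exists>k>0. \<forall>x. norm ((T ^^ k) x) \<le> norm x / 2"
proof -
  have "(\<lambda>k. \<Sum>i\<in>Basis. norm ((T ^^ k) i)) \<longlonglongrightarrow> 0"
    using lim by (intro tendsto_null_sum tendsto_norm_zero)
  then have "\<forall>\<^sub>F k in sequentially. (\<Sum>i\<in>Basis. norm ((T ^^ k) i)) < 1/2"
    by (rule order_tendstoD) simp
  with eventually_gt_at_top[of 0]
  have "\<forall>\<^sub>F k in sequentially. 0 < k \<and> (\<Sum>i\<in>Basis. norm ((T ^^ k) i)) < 1/2"
    by eventually_elim auto
  then obtain k where k: "0 < k" "(\<Sum>i\<in>Basis. norm ((T ^^ k) i)) < 1/2"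
    by (auto simp: eventually_sequentially)
  have lin: "linear (T ^^ k)"
    using \<open>linear T\<close> by (rule linear_funpow)
  have "norm ((T ^^ k) x) \<le> norm x / 2" for x
  proof -
    have "(T ^^ k) x = (T ^^ k) (\<Sum>i\<in>Basis. (x \<bullet> i) *\<^sub>R i)"
      by (simp add: euclidean_representation)
    also have "\<dots> = (\<Sum>i\<in>Basis. (x \<bullet> i) *\<^sub>R (T ^^ k) i)"
      using lin by (simp add: linear_sum linear_scale)
    also have "norm \<dots> \<le> (\<Sum>i\<in>Basis. norm x * norm ((T ^^ k) i))"
      by (intro sum_norm_le) (auto intro!: mult_right_mono Basis_le_norm)
    also have "\<dots> \<le> norm x * (1/2)"
      unfolding sum_distrib_left[symmetric] using k by (intro mult_left_mono) auto
    finally show ?thesis by simp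
  qed
  with k show ?thesis by blast
qed

text \<open>A map whose powers tend to 0 is a strict contraction for a suitable norm. With
  \<open>\<parallel>T\<^sup>k x\<parallel> \<le> \<parallel>x\<parallel> / 2\<close> and \<open>a\<^sup>k = 2\<close>, the weighted sum of \<open>a\<^sup>j \<parallel>T\<^sup>j x\<parallel>\<close> over \<open>j < k\<close> shrinks
  by the factor \<open>1 / a\<close>. Only the properties needed below are recorded.\<close>

lemma ex_adapted_norm:
  fixes T :: "'a::euclidean_space \<Rightarrow> 'a"
  assumes "linear T" and lim: "\<And>v. (\<lambda>k. (T ^^ k) v) \<longlonglongrightarrow> 0"
  obtains q :: "'a \<Rightarrow> real" and c where "0 \<le> c" "c < 1" "continuous_on UNIV q"
    "\<And>x. norm x \<le> q x" "\<And>x y. q (x + y) \<le> q x + q y" "\<And>x. q (T x) \<le> c * q x"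
proof -
  obtain k where k: "k > 0" "\<And>x. norm ((T ^^ k) x) \<le> norm x / 2"
    using ex_power_norm_le_half[OF assms] by blast
  define a where "a = root k 2"
  have a: "a > 1" "a ^ k = 2" using k by (auto simp: a_def)
  define q where "q x = (\<Sum>j<k. a ^ j * norm ((T ^^ j) x))" for x
  have lin: "linear (T ^^ j)" for j
    using \<open>linear T\<close> by (rule linear_funpow)
  obtain k' where k': "k = Suc k'" using k(1) gr0_implies_Suc by blast
  show thesis
  proof
    show "0 \<le> 1 / a" "1 / a < 1" using a by auto
    show "continuous_on UNIV q"
      unfolding q_def using lin
      by (intro continuous_intros) (simp add: linear_continuous_on linear_conv_bounded_linear)
    show "norm x \<le> q x" for x
      unfolding q_def k' sum.lessThan_Suc_shift using a by (simp add: sum_nonneg)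
    show "q (x + y) \<le> q x + q y" for x y
      unfolding q_def sum.distrib[symmetric]
    proof (rule sum_mono)
      fix j
      have "a ^ j * norm ((T ^^ j) (x + y)) \<le> a ^ j * (norm ((T ^^ j) x) + norm ((T ^^ j) y))"
        using a(1) by (intro mult_left_mono) (simp_all add: linear_add[OF lin] norm_triangle_ineq)
      then show "a ^ j * norm ((T ^^ j) (x + y)) \<le> a ^ j * norm ((T ^^ j) x) + a ^ j * norm ((T ^^ j) y)"
        by (simp add: distrib_left)
    qed
    show "q (T x) \<le> 1 / a * q x" for x
    proof -
      have "a * q (T x) = (\<Sum>j<k. a ^ Suc j * norm ((T ^^ Suc j) x))"
        by (simp add: q_def sum_distrib_left mult.assoc funpow_swap1)
      also have "\<dots> = (\<Sum>j<Suc k. a ^ j * norm ((T ^^ j) x)) - norm x"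
        unfolding sum.lessThan_Suc_shift by simp
      also have "\<dots> = q x + (2 * norm ((T ^^ k) x) - norm x)"
        by (simp add: q_def a)
      also have "\<dots> \<le> q x" using k(2)[of x] by simp
      finally show ?thesis using a by (simp add: field_simps)
    qed
  qed
qed

section \<open>Invariant measures\<close>

lemma invariant_measureD:
  assumes "invariant_measure A D M"
  shows "prob_space M" "sets M = sets borel" "space M = UNIV"
  using assms sets_eq_imp_space_eq[of M borel] by (auto simp: invariant_measure_def)

lemma borel_measurable_branch:
  "(\<lambda>x. A *v (x + d)) \<in> borel_measurable borel" for A :: "real ^ 'n ^ 'm"
  by (intro borel_measurable_continuous_onI linear_continuous_on_compose[OF _ matrix_vector_mul_linear] continuous_intros)

text \<open>For the adapted norm \<open>q\<close>, each branch maps the ball \<open>K s\<close> into \<open>K (c (s + \<delta>))\<close>, so invariance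
  gives \<open>M (K s) \<le> M (K (c (s + \<delta>)))\<close>. Iterating the contraction \<open>s \<mapsto> c (s + \<delta>)\<close> towards its
  fixed point \<open>p\<close> shows that no ball \<open>K s\<close> has more mass than \<open>K (p + 1)\<close>.\<close>

lemma invariant_measure_bounded_support:
  assumes inv: "invariant_measure A D M" and D: "finite D" "D \<noteq> {}"
    and lim: "\<And>v. (\<lambda>k. ((*v) (matrix_inv A) ^^ k) v) \<longlonglongrightarrow> 0"
  obtains r where "r \<ge> 0" "AE x in M. norm x \<le> r"
proof -
  interpret prob_space M using invariant_measureD[OF inv] by simp
  note M = invariant_measureD[OF inv]
  \<comment> \<open>Here \<open>q\<close> is a norm for which the linear part of the branches contracts.\<close>
  obtain q c where q: "0 \<le> c" "c < 1" "continuous_on UNIV q"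
    "\<And>x. norm x \<le> q x" "\<And>x y. q (x + y) \<le> q x + q y"
    "\<And>x. q (matrix_inv A *v x) \<le> c * q x"
    by (rule ex_adapted_norm[OF matrix_vector_mul_linear lim]) blast
  define K where "K s = {x. q x \<le> s}" for s
  have K[measurable]: "K s \<in> sets M" for s
    unfolding K_def M using q(3) by (intro borel_closed closed_Collect_le) (auto)
  define \<delta> where "\<delta> = Max (q ` D)"
  have \<delta>: "q d \<le> \<delta>" if "d \<in> D" for d using that D by (simp add: \<delta>_def)
  have step: "prob (K s) \<le> prob (K (c * (s + \<delta>)))" for s
  proof -
    have sub: "K s \<subseteq> (\<lambda>x. matrix_inv A *v (x + d)) -` K (c * (s + \<delta>))" if "d \<in> D" for d
    proof
      fix x assume "x \<in> K s"
      then have "q (x + d) \<le> s + \<delta>" using q(5)[of x d] \<delta>[OF that] by (simp add: K_def)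
      then have "c * q (x + d) \<le> c * (s + \<delta>)" using q(1) by (rule mult_left_mono)
      with q(6)[of "x + d"] show "x \<in> (\<lambda>x. matrix_inv A *v (x + d)) -` K (c * (s + \<delta>))"
        by (auto simp: K_def)
    qed
    have "prob (K s) = (1 / real (card D)) * (\<Sum>d\<in>D. prob (K s))"
      using D by simp
    also have "\<dots> \<le> (1 / real (card D)) *
        (\<Sum>d\<in>D. prob ((\<lambda>x. matrix_inv A *v (x + d)) -` K (c * (s + \<delta>))))"
      using sub K[of "c * (s + \<delta>)"] measurable_sets_borel[OF borel_measurable_branch]
      by (intro mult_left_mono sum_mono finite_measure_mono) (auto simp: M)
    also have "\<dots> = prob (K (c * (s + \<delta>)))"
      using inv K[of "c * (s + \<delta>)"] unfolding invariant_measure_def M(2) by simp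
    finally show ?thesis .
  qed
  define p where "p = c * \<delta> / (1 - c)"
  have fixpoint: "c * (p + \<delta>) = p" using q(2) by (simp add: p_def field_simps)
  have iter: "prob (K s) \<le> prob (K (p + c ^ n * (s - p)))" for s n
  proof (induction n)
    case (Suc n)
    have "c * (p + c ^ n * (s - p) + \<delta>) = p + c ^ Suc n * (s - p)"
      using fixpoint by (simp add: algebra_simps)
    with Suc step[of "p + c ^ n * (s - p)"] show ?case by simp
  qed simp
  have bound: "prob (K s) \<le> prob (K (p + 1))" for s
  proof -
    have "(\<lambda>n. c ^ n * (s - p)) \<longlonglongrightarrow> 0"
      using q by (intro tendsto_mult_left_zero LIMSEQ_realpow_zero) auto
    then have "\<forall>\<^sub>F n in sequentially. c ^ n * (s - p) < 1"
      by (rule order_tendstoD) simp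
    then obtain n where n: "c ^ n * (s - p) < 1" by (auto simp: eventually_sequentially)
    have "prob (K s) \<le> prob (K (p + c ^ n * (s - p)))" by (rule iter)
    also have "\<dots> \<le> prob (K (p + 1))"
      using n by (intro finite_measure_mono K) (auto simp: K_def)
    finally show ?thesis .
  qed
  \<comment> \<open>The balls exhaust the space, so the uniform bound forces \<open>K (p + 1)\<close> to have full measure.\<close>
  have "(\<lambda>n. prob (K (real n))) \<longlonglongrightarrow> prob (\<Union>n. K (real n))"
    by (rule finite_Lim_measure_incseq) (use K in \<open>auto simp: incseq_def K_def\<close>)
  moreover have "(\<Union>n. K (real n)) = space M"
    using real_arch_simple by (auto simp: K_def M)
  ultimately have "(\<lambda>n. prob (K (real n))) \<longlonglongrightarrow> 1" by (simp add: prob_space)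
  then have "1 \<le> prob (K (p + 1))"
    by (rule LIMSEQ_le_const2) (auto intro: bound)
  then have "prob (K (p + 1)) = 1" using prob_le_1 by (simp add: antisym)
  then have "AE x in M. x \<in> K (p + 1)" by (rule AE_prob_1)
  then have "AE x in M. norm x \<le> max 0 (p + 1)"
    by eventually_elim (use q(4) in \<open>auto simp: K_def le_max_iff_disj intro: order_trans\<close>)
  then show thesis using that[of "max 0 (p + 1)"] by simp
qed

text \<open>The image of \<open>M\<close> under a single branch is at most \<open>card D\<close> times \<open>M\<close>.\<close>

lemma invariant_measure_integrable:
  fixes f :: "real ^ 'n \<Rightarrow> 'b::{banach, second_countable_topology}"
  assumes inv: "invariant_measure A D M" and D: "finite D" "d \<in> D"
    and f: "integrable M f"
  shows "integrable M (\<lambda>x. f (matrix_inv A *v (x + d)))"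
proof -
  interpret prob_space M using invariant_measureD[OF inv] by simp
  note M = invariant_measureD[OF inv]
  let ?\<tau> = "\<lambda>d x. matrix_inv A *v (x + d)"
  have br[measurable]: "?\<tau> d \<in> measurable M M" for d
    using borel_measurable_branch by (simp add: measurable_cong_sets[OF M(2) M(2)])
  have N: "card D > 0" using D by (auto simp: card_gt_0_iff)
  have le: "distr M M (?\<tau> d) \<le> scale_measure (ennreal (real (card D))) M"
  proof (rule le_measure[THEN iffD2])
    show "\<forall>E\<in>sets (distr M M (?\<tau> d)). emeasure (distr M M (?\<tau> d)) E
        \<le> emeasure (scale_measure (ennreal (real (card D))) M) E"
    proof
      fix E assume "E \<in> sets (distr M M (?\<tau> d))"
      then have E[measurable]: "E \<in> sets M" by simp
      have "prob (?\<tau> d -` E) \<le> (\<Sum>d\<in>D. prob (?\<tau> d -` E))"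
        using D by (intro member_le_sum) auto
      also have "\<dots> = real (card D) * prob E"
        using inv E N unfolding invariant_measure_def M(2) by simp
      finally show "emeasure (distr M M (?\<tau> d)) E
          \<le> emeasure (scale_measure (ennreal (real (card D))) M) E"
        by (subst emeasure_distr[OF br E]) (simp add: M emeasure_eq_measure ennreal_leI ennreal_mult[symmetric])
    qed
  qed simp
  have [measurable]: "f \<in> borel_measurable M" using f by simp
  have "(\<integral>\<^sup>+x. norm (f (?\<tau> d x)) \<partial>M) = (\<integral>\<^sup>+x. norm (f x) \<partial>distr M M (?\<tau> d))"
    by (subst nn_integral_distr) auto
  also have "\<dots> \<le> (\<integral>\<^sup>+x. norm (f x) \<partial>scale_measure (ennreal (real (card D))) M)"
    using le by (intro nn_integral_mono_measure) auto
  also have "\<dots> = ennreal (real (card D)) * (\<integral>\<^sup>+x. norm (f x) \<partial>M)"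
    by (rule nn_integral_scale_measure) simp
  also have "\<dots> < \<infinity>"
    using f by (auto simp: integrable_iff_bounded ennreal_mult_less_top)
  finally show ?thesis by (simp add: integrable_iff_bounded)
qed

lemma invariant_measure_integral:
  fixes f :: "real ^ 'n \<Rightarrow> 'b::{banach, second_countable_topology}"
  assumes inv: "invariant_measure A D M" and D: "finite D"
    and f: "integrable M f"
  shows "(\<integral>x. f x \<partial>M) = (\<Sum>d\<in>D. \<integral>x. f (matrix_inv A *v (x + d)) \<partial>M) /\<^sub>R real (card D)"
  using f
proof (induction rule: integrable_induct)
  interpret prob_space M using invariant_measureD[OF inv] by simp
  note M = invariant_measureD[OF inv]
  have br[measurable]: "(\<lambda>x. matrix_inv A *v (x + d)) \<in> measurable M M" for d
    using borel_measurable_branch by (simp add: measurable_cong_sets[OF M(2) M(2)])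
  {
    case (base E c)
    let ?V = "\<lambda>d. (\<lambda>x. matrix_inv A *v (x + d)) -` E"
    have V: "?V d \<in> sets M" for d
      using measurable_sets[OF br base(1)] by (simp add: M)
    have ind: "indicator E (matrix_inv A *v (x + d)) = (indicator (?V d) x :: real)" for x d
      by (simp add: indicator_def)
    have "prob E = (\<Sum>d\<in>D. prob (?V d)) / real (card D)"
      using inv base(1) unfolding invariant_measure_def M(2) by simp
    then show ?case
      using V base(1) by (simp add: ind scaleR_sum_left[symmetric] divide_inverse mult.commute less_top[symmetric])
  next
    case (add f g)
    then show ?case
      by (simp add: sum.distrib scaleR_add_right invariant_measure_integrable[OF inv D])
  next
    case (lim f s)
    note [measurable] = borel_measurable_integrable[OF lim.hyps(4)] borel_measurable_integrable[OF lim.hyps(1)]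
    have f2: "integrable M (\<lambda>x. 2 * norm (f x))" using lim.hyps(4) by simp
    have "(\<lambda>i. \<integral>x. s i x \<partial>M) \<longlonglongrightarrow> (\<integral>x. f x \<partial>M)"
      using lim.hyps(2,3) by (intro integral_dominated_convergence[OF _ _ f2]) auto
    moreover have "(\<lambda>i. (\<Sum>d\<in>D. \<integral>x. s i (matrix_inv A *v (x + d)) \<partial>M) /\<^sub>R real (card D))
        \<longlonglongrightarrow> (\<Sum>d\<in>D. \<integral>x. f (matrix_inv A *v (x + d)) \<partial>M) /\<^sub>R real (card D)"
      using lim.hyps(2,3)
      by (intro tendsto_intros integral_dominated_convergence[OF _ _ invariant_measure_integrable[OF inv D _ f2]])
        (auto simp: M)
    ultimately show ?case
      unfolding lim.IH by (rule LIMSEQ_unique)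
  }
qed

section \<open>Orthogonality of the exponentials\<close>

lemma exp_2pi_Ints:
  assumes "x \<in> \<int>"
  shows "exp (2 * complex_of_real pi * \<i> * complex_of_real x) = 1"
proof -
  from assms obtain m where "x = of_int m" by (auto elim: Ints_cases)
  then show ?thesis by (auto simp: exp_eq_1 intro!: exI[of _ m])
qed

lemma integrable_character:
  fixes M :: "(real ^ 'n) measure"
  assumes "prob_space M" "sets M = sets borel"
  shows "integrable M (\<lambda>x. exp (2 * complex_of_real pi * \<i> * complex_of_real (t \<bullet> x)))"
proof -
  interpret prob_space M by fact
  have [measurable]: "(\<lambda>x. x) \<in> borel_measurable M" using assms by (simp add: measurable_ident_sets)
  show ?thesis
    by (rule integrable_const_bound[where B=1]) auto
qed

lemma inner_matrix_vector_mult: "t \<bullet> (A *v x) = (transpose A *v t) \<bullet> x" for A :: "real ^ 'n ^ 'm"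
  by (simp add: dot_lmul_matrix)

text \<open>The refinement equation of the Fourier transform: a trigonometric mask times a rescaled copy.\<close>

lemma fourier_refinement:
  assumes inv: "invariant_measure A D M" and D: "finite D"
  shows "fourier M t =
    (\<Sum>d\<in>D. exp (2 * complex_of_real pi * \<i> * complex_of_real ((matrix_inv A *v d) \<bullet> t)))
      / of_nat (card D) * fourier M (transpose (matrix_inv A) *v t)"
proof -
  note M = invariant_measureD[OF inv]
  let ?e = "\<lambda>x. exp (2 * complex_of_real pi * \<i> * complex_of_real x)"
  have "?e (t \<bullet> (matrix_inv A *v (x + d))) =
      ?e ((matrix_inv A *v d) \<bullet> t) * ?e ((transpose (matrix_inv A) *v t) \<bullet> x)" for x d
    unfolding inner_matrix_vector_mult[symmetric]
    by (simp add: matrix_vector_right_distrib inner_add_right inner_commute[of t] ring_distribs exp_add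
        del: transpose_matrix_vector)
  then have "fourier M t = (\<Sum>d\<in>D. \<integral>x. ?e ((matrix_inv A *v d) \<bullet> t)
      * ?e ((transpose (matrix_inv A) *v t) \<bullet> x) \<partial>M) /\<^sub>R real (card D)"
    unfolding fourier_def
    by (subst invariant_measure_integral[OF inv D integrable_character[OF M(1,2)]]) simp
  then show ?thesis
    by (simp add: fourier_def sum_distrib_right[symmetric] scaleR_conv_of_real field_simps)
qed

lemma funpow_transpose_inner:
  fixes A :: "real ^ 'n ^ 'n"
  shows "((*v) (transpose A) ^^ k) l \<bullet> d = ((*v) A ^^ k) d \<bullet> l"
proof (induction k arbitrary: d)
  case 0 then show ?case by (simp add: inner_commute)
next
  case (Suc k)
  have "((*v) (transpose A) ^^ Suc k) l \<bullet> d = ((*v) (transpose A) ^^ k) l \<bullet> (A *v d)"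
    by (simp add: dot_lmul_matrix)
  then show ?case by (simp add: Suc funpow_swap1 del: transpose_matrix_vector)
qed

text \<open>Orthogonality of the columns of the Hadamard matrix: the mask vanishes at differences of distinct digits.\<close>

lemma hadamard_system_character_sum:
  assumes H: "hadamard_system A D L" and l: "l \<in> L" "l' \<in> L" "l \<noteq> l'"
  shows "(\<Sum>d\<in>D. exp (2 * complex_of_real pi * \<i> * complex_of_real ((matrix_inv A *v d) \<bullet> (l - l')))) = 0"
proof -
  let ?e = "\<lambda>x. exp (2 * complex_of_real pi * \<i> * complex_of_real x)"
  have N: "card D > 0" using H by (auto simp: hadamard_system_def card_gt_0_iff)
  have "0 = (\<Sum>d\<in>D. cnj (?e ((matrix_inv A *v d) \<bullet> l') / complex_of_real (sqrt (real (card D))))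
      * (?e ((matrix_inv A *v d) \<bullet> l) / complex_of_real (sqrt (real (card D)))))"
    using H l unfolding hadamard_system_def unitary_on_def by auto
  also have "\<dots> = (\<Sum>d\<in>D. ?e ((matrix_inv A *v d) \<bullet> (l - l')) / of_nat (card D))"
  proof (rule sum.cong[OF refl])
    fix d
    have "complex_of_real (sqrt (real (card D))) * complex_of_real (sqrt (real (card D))) = of_nat (card D)"
      by (simp flip: of_real_mult)
    moreover have "cnj (?e ((matrix_inv A *v d) \<bullet> l')) * ?e ((matrix_inv A *v d) \<bullet> l)
        = ?e ((matrix_inv A *v d) \<bullet> (l - l'))"
      by (simp add: exp_cnj inner_diff_right ring_distribs flip: exp_add)
    ultimately show "cnj (?e ((matrix_inv A *v d) \<bullet> l') / complex_of_real (sqrt (real (card D))))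
      * (?e ((matrix_inv A *v d) \<bullet> l) / complex_of_real (sqrt (real (card D))))
      = ?e ((matrix_inv A *v d) \<bullet> (l - l')) / of_nat (card D)"
      by (simp add: times_divide_times_eq)
  qed
  finally show ?thesis using N by (simp flip: sum_divide_distrib)
qed

text \<open>The two sums are compared at their lowest digit. By the integrality condition the mask at their
  difference depends on the lowest digits only: it vanishes if they differ, and it equals 1 if they agree,
  in which case the refinement equation strips the lowest digit off.\<close>

lemma fourier_digit_sum_diff:
  fixes A :: "real ^ 'n ^ 'n"
  defines "\<Sigma> \<equiv> \<lambda>n c. \<Sum>k<n. ((*v) (transpose A) ^^ k) (c k)"
  assumes H: "hadamard_system A D L" and inv: "invariant_measure A D M"
    and "\<And>k. c k \<in> L" "\<And>k. c' k \<in> L" "\<Sigma> n c \<noteq> \<Sigma> n c'"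
  shows "fourier M (\<Sigma> n c - \<Sigma> n c') = 0"
  using assms(4-)
proof (induction n arbitrary: c c')
  case 0 then show ?case by (simp add: \<Sigma>_def)
next
  case (Suc n)
  have D: "finite D" and N: "card D > 0" and A: "invertible A"
    using H expansive_invertible by (auto simp: hadamard_system_def card_gt_0_iff)
  have AA: "A *v (matrix_inv A *v x) = x" for x
    by (simp add: matrix_vector_mul_assoc matrix_inv_right[OF A])
  let ?e = "\<lambda>x. exp (2 * complex_of_real pi * \<i> * complex_of_real x)"
  define \<delta> where "\<delta> = \<Sigma> n (\<lambda>k. c (Suc k)) - \<Sigma> n (\<lambda>k. c' (Suc k))"
  have shift: "\<Sigma> (Suc n) c = c 0 + transpose A *v \<Sigma> n (\<lambda>k. c (Suc k))" for c
    unfolding \<Sigma>_def sum.lessThan_Suc_shift by (simp add: vec.linear_sum del: transpose_matrix_vector)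
  have diff: "\<Sigma> (Suc n) c - \<Sigma> (Suc n) c' = (c 0 - c' 0) + transpose A *v \<delta>"
    unfolding shift \<delta>_def by (simp only: matrix_vector_mult_diff_distrib) simp
  have int: "d \<bullet> \<delta> \<in> \<int>" if "d \<in> D" for d
    unfolding \<delta>_def \<Sigma>_def inner_diff_right inner_sum_right
    using H that Suc.prems(1,2)
    by (intro Ints_diff Ints_sum) (auto simp: inner_commute[of d] funpow_transpose_inner hadamard_system_def)
  have phase: "?e ((matrix_inv A *v d) \<bullet> ((c 0 - c' 0) + transpose A *v \<delta>))
      = ?e ((matrix_inv A *v d) \<bullet> (c 0 - c' 0))" if "d \<in> D" for d
  proof -
    have "(matrix_inv A *v d) \<bullet> (transpose A *v \<delta>) = d \<bullet> \<delta>"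
      by (metis AA inner_commute inner_matrix_vector_mult)
    then show ?thesis
      using exp_2pi_Ints[OF int[OF that]] by (simp only: inner_add_right of_real_add ring_distribs exp_add) simp
  qed
  have F: "fourier M (\<Sigma> (Suc n) c - \<Sigma> (Suc n) c') =
      (\<Sum>d\<in>D. ?e ((matrix_inv A *v d) \<bullet> (c 0 - c' 0))) / of_nat (card D)
        * fourier M (transpose (matrix_inv A) *v ((c 0 - c' 0) + transpose A *v \<delta>))"
    unfolding diff by (subst fourier_refinement[OF inv D]) (simp only: phase cong: sum.cong)
  show ?case
  proof (cases "c 0 = c' 0")
    case True
    have "transpose (matrix_inv A) *v (transpose A *v \<delta>) = transpose (A ** matrix_inv A) *v \<delta>"
      by (simp add: matrix_transpose_mul matrix_vector_mul_assoc del: transpose_matrix_vector)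
    then have "transpose (matrix_inv A) *v (transpose A *v \<delta>) = \<delta>"
      by (simp add: matrix_inv_right[OF A] transpose_mat del: transpose_matrix_vector)
    then have F': "fourier M (\<Sigma> (Suc n) c - \<Sigma> (Suc n) c') = fourier M \<delta>"
      using N by (simp add: F True del: transpose_matrix_vector)
    have "\<delta> \<noteq> 0" using Suc.prems(3) diff True by auto
    then have "fourier M \<delta> = 0"
      unfolding \<delta>_def using Suc.prems by (intro Suc.IH) auto
    with F' show ?thesis by simp
  next
    case False
    then show ?thesis
      using F hadamard_system_character_sum[OF H] Suc.prems by simp
  qed
qed

text \<open>As 0 is a digit, every digit sum can be padded to any larger length.\<close>

lemma digit_sums_padded:
  assumes "\<gamma> \<in> digit_sums A D" "0 \<in> D"
  obtains c m where "\<And>k. c k \<in> D" "\<And>n. n \<ge> m \<Longrightarrow> \<gamma> = (\<Sum>k<n. ((*v) A ^^ k) (c k))"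
proof -
  from assms obtain c m where c: "\<gamma> = (\<Sum>k\<le>m. ((*v) A ^^ k) (c k))" "\<And>k. k \<le> m \<Longrightarrow> c k \<in> D"
    by (auto simp: digit_sums_def)
  define c' where "c' k = (if k \<le> m then c k else 0)" for k
  have z: "((*v) A ^^ k) 0 = 0" for k by (induction k) auto
  show thesis
  proof
    show "c' k \<in> D" for k using c(2) assms(2) by (simp add: c'_def)
    show "\<gamma> = (\<Sum>k<n. ((*v) A ^^ k) (c' k))" if "n \<ge> Suc m" for n
      unfolding c(1) using that
      by (intro sum.mono_neutral_cong_left) (auto simp: c'_def z)
  qed
qed

lemma hadamard_system_orthogonal:
  assumes H: "hadamard_system A D L" and inv: "invariant_measure A D M"
    and "\<gamma> \<in> digit_sums (transpose A) L" "\<gamma>' \<in> digit_sums (transpose A) L" "\<gamma> \<noteq> \<gamma>'"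
  shows "fourier M (\<gamma> - \<gamma>') = 0"
proof -
  have 0: "0 \<in> L" using H by (simp add: hadamard_system_def)
  obtain c m where c: "\<And>k. c k \<in> L" "\<And>n. n \<ge> m \<Longrightarrow> \<gamma> = (\<Sum>k<n. ((*v) (transpose A) ^^ k) (c k))"
    using digit_sums_padded[OF assms(3) 0] by blast
  obtain c' m' where c': "\<And>k. c' k \<in> L" "\<And>n. n \<ge> m' \<Longrightarrow> \<gamma>' = (\<Sum>k<n. ((*v) (transpose A) ^^ k) (c' k))"
    using digit_sums_padded[OF assms(4) 0] by blast
  show ?thesis
    using fourier_digit_sum_diff[OF H inv, of c c' "max m m'"] c c' assms(5)
      c(2)[of "max m m'"] c'(2)[of "max m m'"] by simp
qed

section \<open>Bessel's inequality\<close>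

text \<open>Bessel's inequality for the unimodular orthogonal family of the conjugates of the \<open>\<phi> i\<close>; the square of
  the norm of the remainder \<open>h\<close> of \<open>g\<close> is expanded.\<close>

lemma bessel_inequality:
  fixes \<phi> :: "'i \<Rightarrow> 'a \<Rightarrow> complex"
  assumes "prob_space M" and F: "finite F"
    and meas: "\<And>i. \<phi> i \<in> borel_measurable M" and one: "\<And>i x. cmod (\<phi> i x) = 1"
    and orth: "\<And>i j. i \<in> F \<Longrightarrow> j \<in> F \<Longrightarrow> i \<noteq> j \<Longrightarrow> (\<integral>x. \<phi> i x * cnj (\<phi> j x) \<partial>M) = 0"
    and g: "g \<in> borel_measurable M" "AE x in M. cmod (g x) \<le> C"
  shows "(\<Sum>i\<in>F. (cmod (\<integral>x. g x * \<phi> i x \<partial>M))\<^sup>2) \<le> C\<^sup>2"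
proof -
  interpret prob_space M by fact
  note [measurable] = meas g(1)
  have [measurable]: "(\<lambda>x. cnj (f x)) \<in> borel_measurable M" if "f \<in> borel_measurable M" for f
    using that by (rule borel_measurable_continuous_on[rotated]) (intro continuous_intros)
  define c where "c i = (\<integral>x. g x * \<phi> i x \<partial>M)" for i
  define h where "h x = g x - (\<Sum>i\<in>F. c i * cnj (\<phi> i x))" for x
  have [measurable]: "h \<in> borel_measurable M" unfolding h_def by measurable
  have ig: "integrable M (\<lambda>x. g x * cnj (g x))"
    using g(2) by (intro integrable_const_bound[where B="C * C"])
      (auto simp: norm_mult elim!: eventually_mono intro!: mult_mono intro: order_trans[OF norm_ge_zero])
  have i1: "integrable M (\<lambda>x. g x * \<phi> i x)" for i
    using g(2) by (intro integrable_const_bound[where B="C"]) (auto simp: norm_mult one)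
  have i1': "integrable M (\<lambda>x. cnj (g x) * cnj (\<phi> i x))" for i
    using integrable_cnj[OF i1[of i]] by simp
  have i2: "integrable M (\<lambda>x. \<phi> i x * cnj (\<phi> j x))" for i j
    by (intro integrable_const_bound[where B=1]) (auto simp: norm_mult one)
  have c': "(\<integral>x. cnj (g x) * cnj (\<phi> i x) \<partial>M) = cnj (c i)" for i
    unfolding c_def by (subst Bochner_Integration.integral_cnj[symmetric]) simp
  have gram: "(\<integral>x. \<phi> i x * cnj (\<phi> j x) \<partial>M) = (if i = j then 1 else 0)" if "i \<in> F" "j \<in> F" for i j
    using orth[OF that] by (auto simp: complex_norm_square[symmetric] one prob_space)
  have hh: "h x * cnj (h x) = g x * cnj (g x) - (\<Sum>i\<in>F. c i * (cnj (g x) * cnj (\<phi> i x)))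
      - (\<Sum>i\<in>F. cnj (c i) * (g x * \<phi> i x))
      + (\<Sum>i\<in>F. \<Sum>j\<in>F. c j * cnj (c i) * (\<phi> i x * cnj (\<phi> j x)))" for x
    by (simp add: h_def algebra_simps sum_product sum_distrib_left)
  have "of_real (\<integral>x. (cmod (h x))\<^sup>2 \<partial>M) = (\<integral>x. h x * cnj (h x) \<partial>M)"
    by (simp add: complex_norm_square[symmetric] flip: of_real_power)
  also have "\<dots> = (\<integral>x. g x * cnj (g x) \<partial>M) - (\<Sum>i\<in>F. c i * cnj (c i))
      - (\<Sum>i\<in>F. cnj (c i) * c i) + (\<Sum>i\<in>F. \<Sum>j\<in>F. c j * cnj (c i) * (if i = j then 1 else 0))"
    unfolding hh by (simp add: ig i1 i1' i2 c' gram c_def[symmetric] cong: sum.cong)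
  also have "(\<Sum>i\<in>F. \<Sum>j\<in>F. c j * cnj (c i) * (if i = j then 1 else 0)) = (\<Sum>i\<in>F. c i * cnj (c i))"
    using F by (simp add: if_distrib sum.delta cong: if_cong)
  finally have "complex_of_real (\<integral>x. (cmod (h x))\<^sup>2 \<partial>M)
      = of_real ((\<integral>x. (cmod (g x))\<^sup>2 \<partial>M) - (\<Sum>i\<in>F. (cmod (c i))\<^sup>2))"
    by (simp add: complex_norm_square[symmetric] mult.commute[of "cnj _"] flip: of_real_power)
  then have "(\<integral>x. (cmod (h x))\<^sup>2 \<partial>M) = (\<integral>x. (cmod (g x))\<^sup>2 \<partial>M) - (\<Sum>i\<in>F. (cmod (c i))\<^sup>2)"
    unfolding of_real_eq_iff .
  moreover have "0 \<le> (\<integral>x. (cmod (h x))\<^sup>2 \<partial>M)" by simp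
  moreover have "(\<integral>x. (cmod (g x))\<^sup>2 \<partial>M) \<le> (\<integral>x. C\<^sup>2 \<partial>M)"
  proof (rule integral_mono_AE)
    show "integrable M (\<lambda>x. (cmod (g x))\<^sup>2)"
      using integrable_norm[OF ig] by (simp add: norm_mult power2_eq_square)
  qed (use g(2) in \<open>auto elim!: eventually_mono intro!: power_mono\<close>)
  ultimately show ?thesis by (simp add: c_def prob_space)
qed

section \<open>Differentiating pairings of square-summable families\<close>

text \<open>The family \<open>a\<close> restricted to \<open>I\<close> has norm at most \<open>C\<close> in \<open>\<ell>\<^sup>2\<close>, expressed through finite subsets of \<open>I\<close>.\<close>

definition l2_le :: "'i set \<Rightarrow> ('i \<Rightarrow> complex) \<Rightarrow> real \<Rightarrow> bool" where
  "l2_le I a C \<longleftrightarrow> (\<forall>F. finite F \<longrightarrow> F \<subseteq> I \<longrightarrow> L2_set (\<lambda>i. cmod (a i)) F \<le> C)"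

lemma l2_le_add:
  assumes "l2_le I a C" "l2_le I b K"
  shows "l2_le I (\<lambda>i. a i + b i) (C + K)"
  unfolding l2_le_def
proof (intro allI impI)
  fix F assume F: "finite F" "F \<subseteq> I"
  have "L2_set (\<lambda>i. cmod (a i + b i)) F \<le> L2_set (\<lambda>i. cmod (a i) + cmod (b i)) F"
    by (intro L2_set_mono) (auto simp: norm_triangle_ineq)
  also have "\<dots> \<le> L2_set (\<lambda>i. cmod (a i)) F + L2_set (\<lambda>i. cmod (b i)) F"
    by (rule L2_set_triangle_ineq)
  also have "\<dots> \<le> C + K" using assms F by (auto simp: l2_le_def intro: add_mono)
  finally show "L2_set (\<lambda>i. cmod (a i + b i)) F \<le> C + K" .
qed

lemma l2_le_mono: "l2_le I a C \<Longrightarrow> C \<le> K \<Longrightarrow> l2_le I a K"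
  by (force simp: l2_le_def)

lemma l2_le_mult:
  assumes "l2_le I a C" "l2_le I b K"
  shows "(\<lambda>i. cmod (a i * b i)) summable_on I" "cmod (\<Sum>\<^sub>\<infinity>i\<in>I. a i * b i) \<le> C * K"
proof -
  have C: "0 \<le> C" using assms(1) by (auto simp: l2_le_def dest!: spec[of _ "{}"])
  have bd: "(\<Sum>i\<in>F. cmod (a i * b i)) \<le> C * K" if F: "finite F" "F \<subseteq> I" for F
  proof -
    have "(\<Sum>i\<in>F. cmod (a i * b i)) = (\<Sum>i\<in>F. \<bar>cmod (a i)\<bar> * \<bar>cmod (b i)\<bar>)"
      by (simp add: norm_mult)
    also have "\<dots> \<le> L2_set (\<lambda>i. cmod (a i)) F * L2_set (\<lambda>i. cmod (b i)) F"
      by (rule L2_set_mult_ineq)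
    also have "\<dots> \<le> C * K"
      using assms F C by (intro mult_mono) (auto simp: l2_le_def)
    finally show ?thesis .
  qed
  show s: "(\<lambda>i. cmod (a i * b i)) summable_on I"
    using bd by (intro nonneg_bdd_above_summable_on) (auto simp: bdd_above_def)
  have "cmod (\<Sum>\<^sub>\<infinity>i\<in>I. a i * b i) \<le> (\<Sum>\<^sub>\<infinity>i\<in>I. cmod (a i * b i))"
    by (rule norm_infsum_bound[OF s])
  also have "\<dots> \<le> C * K" by (rule infsum_le_finite_sums[OF s bd])
  finally show "cmod (\<Sum>\<^sub>\<infinity>i\<in>I. a i * b i) \<le> C * K" .
qed

lemmas l2_le_mult_summable = abs_summable_summable[OF l2_le_mult(1)]

lemma infsum_diff:
  fixes f g :: "'i \<Rightarrow> complex"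
  assumes "f summable_on I" "g summable_on I"
  shows "(\<Sum>\<^sub>\<infinity>i\<in>I. f i - g i) = infsum f I - infsum g I"
    and "(\<lambda>i. f i - g i) summable_on I"
  using infsum_add[of f I "\<lambda>i. - g i"] summable_on_add[of f I "\<lambda>i. - g i"] assms
  by (simp_all add: summable_on_uminus infsum_uminus)

lemma scaleR_eq_smult: "r *\<^sub>R v = complex_of_real r *s v" for v :: "complex ^ 'n"
  by (simp add: vec_eq_iff scaleR_conv_of_real[where 'a=complex])

text \<open>The product rule for the bilinear pairing of \<open>\<ell>\<^sup>2\<close> with itself: if \<open>a\<close> and \<open>b\<close>, as maps
  into \<open>\<ell>\<^sup>2\<close>, have complex-linear derivatives \<open>a'\<close> and \<open>b'\<close> at \<open>z\<close> with remainders of second order,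
  then the sum of the products is complex differentiable at \<open>z\<close>.\<close>

lemma complex_derivative_infsum_mult:
  fixes a b :: "complex ^ 'n \<Rightarrow> 'i \<Rightarrow> complex"
  assumes az: "l2_le I (a z) K" and bz: "l2_le I (b z) K"
    and a': "\<And>v. l2_le I (a' v) (K * norm v)" and b': "\<And>v. l2_le I (b' v) (K * norm v)"
    and ra: "\<And>v. norm v \<le> 1 \<Longrightarrow> l2_le I (\<lambda>i. a (z + v) i - a z i - a' v i) (K * (norm v)\<^sup>2)"
    and rb: "\<And>v. norm v \<le> 1 \<Longrightarrow> l2_le I (\<lambda>i. b (z + v) i - b z i - b' v i) (K * (norm v)\<^sup>2)"
    and add: "\<And>u v i. a' (u + v) i = a' u i + a' v i" "\<And>u v i. b' (u + v) i = b' u i + b' v i"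
    and smult: "\<And>c v i. a' (c *s v) i = c * a' v i" "\<And>c v i. b' (c *s v) i = c * b' v i"
  shows "\<exists>D. ((\<lambda>w. \<Sum>\<^sub>\<infinity>i\<in>I. a w i * b w i) has_derivative D) (at z) \<and> (\<forall>c v. D (c *s v) = c * D v)"
proof -
  define F where "F w = (\<Sum>\<^sub>\<infinity>i\<in>I. a w i * b w i)" for w
  define D where "D v = (\<Sum>\<^sub>\<infinity>i\<in>I. a' v i * b z i + a z i * b' v i)" for v
  note sD1 = l2_le_mult_summable[OF a' bz] and sD2 = l2_le_mult_summable[OF az b']
  have K: "0 \<le> K" using az by (auto simp: l2_le_def dest!: spec[of _ "{}"])
  have D_smult: "D (c *s v) = c * D v" for c v
  proof -
    have "D (c *s v) = (\<Sum>\<^sub>\<infinity>i\<in>I. c * (a' v i * b z i + a z i * b' v i))"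
      unfolding D_def smult by (simp add: algebra_simps)
    then show ?thesis by (simp add: D_def infsum_cmult_right')
  qed
  have D_add: "D (u + v) = D u + D v" for u v
  proof -
    have "D (u + v) = (\<Sum>\<^sub>\<infinity>i\<in>I. (a' u i * b z i + a z i * b' u i) + (a' v i * b z i + a z i * b' v i))"
      unfolding D_def add by (simp add: algebra_simps)
    also have "\<dots> = D u + D v"
      unfolding D_def by (intro infsum_add summable_on_add sD1 sD2)
    finally show ?thesis .
  qed
  have D_bound: "cmod (D v) \<le> norm v * (2 * K\<^sup>2)" for v
  proof -
    have "D v = (\<Sum>\<^sub>\<infinity>i\<in>I. a' v i * b z i) + (\<Sum>\<^sub>\<infinity>i\<in>I. a z i * b' v i)"
      unfolding D_def by (intro infsum_add sD1 sD2)
    also have "cmod \<dots> \<le> (K * norm v) * K + K * (K * norm v)"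
      by (intro norm_triangle_mono l2_le_mult a' b' az bz)
    finally show ?thesis by (simp add: power2_eq_square algebra_simps)
  qed
  have "bounded_linear D"
    by (rule bounded_linear_intro[where K="2 * K\<^sup>2"])
       (simp_all add: D_add D_smult D_bound scaleR_eq_smult scaleR_conv_of_real)
  have est: "cmod (F (z + v) - F z - D v) \<le> 6 * K\<^sup>2 * (norm v)\<^sup>2" if v: "norm v \<le> 1" for v
  proof -
    have sq: "K * (norm v)\<^sup>2 \<le> K * norm v" and lin: "K * norm v \<le> K"
      using v K by (auto intro!: mult_left_mono mult_left_le simp: power2_eq_square)
    have inc: "l2_le I (\<lambda>i. f (z + v) i - f z i) (2 * (K * norm v))"
      if "l2_le I (\<lambda>i. f (z + v) i - f z i - f' v i) (K * (norm v)\<^sup>2)" "l2_le I (f' v) (K * norm v)"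
      for f f' :: "complex ^ 'n \<Rightarrow> 'i \<Rightarrow> complex"
      using l2_le_mono[OF l2_le_add[OF that]] sq by simp
    have val: "l2_le I (f (z + v)) (3 * K)"
      if "l2_le I (\<lambda>i. f (z + v) i - f z i) (2 * (K * norm v))" "l2_le I (f z) K"
      for f :: "complex ^ 'n \<Rightarrow> 'i \<Rightarrow> complex"
      using l2_le_mono[OF l2_le_add[OF that]] lin by simp
    note ia = inc[of a a', OF ra[OF v] a'] and ib = inc[of b b', OF rb[OF v] b']
    note va = val[of a, OF ia az] and vb = val[of b, OF ib bz]
    note s = l2_le_mult_summable
    have "F (z + v) - F z - D v
        = (\<Sum>\<^sub>\<infinity>i\<in>I. a (z + v) i * b (z + v) i - a z i * b z i - (a' v i * b z i + a z i * b' v i))"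
      unfolding F_def D_def
      by (simp only: infsum_diff s[OF va vb] s[OF az bz] summable_on_add[OF sD1 sD2])
    \<comment> \<open>Regrouped so that every product contains a second-order remainder or two first-order factors.\<close>
    also have "\<dots> = (\<Sum>\<^sub>\<infinity>i\<in>I. (a (z + v) i - a z i - a' v i) * b (z + v) i
        + a z i * (b (z + v) i - b z i - b' v i) + a' v i * (b (z + v) i - b z i))"
      by (simp add: algebra_simps)
    also have "\<dots> = (\<Sum>\<^sub>\<infinity>i\<in>I. (a (z + v) i - a z i - a' v i) * b (z + v) i)
        + (\<Sum>\<^sub>\<infinity>i\<in>I. a z i * (b (z + v) i - b z i - b' v i)) + (\<Sum>\<^sub>\<infinity>i\<in>I. a' v i * (b (z + v) i - b z i))"
      by (simp add: infsum_add summable_on_add s[OF ra[OF v] vb] s[OF az rb[OF v]] s[OF a' ib])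
    also have "cmod \<dots> \<le> (K * (norm v)\<^sup>2) * (3 * K) + K * (K * (norm v)\<^sup>2) + (K * norm v) * (2 * (K * norm v))"
      by (intro norm_triangle_mono l2_le_mult(2) ra rb v vb az a' ib)
    also have "\<dots> = 6 * K\<^sup>2 * (norm v)\<^sup>2" by (simp add: power2_eq_square)
    finally show ?thesis .
  qed
  have "(F has_derivative D) (at z)"
  proof (rule has_derivativeI_sandwich[of 1, OF _ \<open>bounded_linear D\<close>])
    show "cmod (F y - F z - D (y - z)) / norm (y - z) \<le> 6 * K\<^sup>2 * norm (y - z)"
      if "y \<noteq> z" "dist y z < 1" for y
      using est[of "y - z"] that by (simp add: dist_norm divide_simps power2_eq_square)
    show "((\<lambda>y. 6 * K\<^sup>2 * norm (y - z)) \<longlongrightarrow> 0) (at z)"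
      by (auto intro!: tendsto_eq_intros)
  qed simp
  then show ?thesis using D_smult unfolding F_def by blast
qed

section \<open>Exponentials with complex frequencies\<close>

text \<open>The complex-bilinear extension of \<open>t \<bullet> x\<close> to complex \<open>t\<close>.\<close>

definition cdot :: "complex ^ 'n \<Rightarrow> real ^ 'n \<Rightarrow> complex" where
  "cdot z x = (\<Sum>i\<in>UNIV. z $ i * complex_of_real (x $ i))"

lemma cdot_add: "cdot (u + v) x = cdot u x + cdot v x"
  by (simp add: cdot_def ring_distribs sum.distrib)

lemma cdot_smult: "cdot (c *s v) x = c * cdot v x"
  by (simp add: cdot_def sum_distrib_left mult.assoc)

lemma cdot_cvec: "cdot (cvec t) x = complex_of_real (t \<bullet> x)"
  by (simp add: cdot_def cvec_def inner_vec_def)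

lemma continuous_on_cdot [continuous_intros]: "continuous_on S (cdot z)"
  unfolding cdot_def by (intro continuous_intros)

lemma norm_cdot_le: "cmod (cdot z x) \<le> real CARD('n) * norm z * norm x"
  for z :: "complex ^ 'n"
proof -
  have "cmod (cdot z x) \<le> (\<Sum>i\<in>(UNIV :: 'n set). norm z * norm x)"
    unfolding cdot_def
    by (intro sum_norm_le) (auto simp: norm_mult 
      intro!: mult_mono Finite_Cartesian_Product.norm_nth_le component_le_norm_cart)
  then show ?thesis by simp
qed

text \<open>On a ball the exponentials \<open>x \<mapsto> exp (\<kappa> (z \<cdot> x))\<close>, as functions of \<open>z\<close>, have a first-order Taylor
  expansion that is uniform in \<open>x\<close>.\<close>

lemma exp_cdot_bounds:
  fixes z :: "complex ^ 'n"
  assumes r: "0 \<le> r"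
  obtains K where "0 \<le> K"
    "\<And>x. norm x \<le> r \<Longrightarrow> cmod (exp (\<kappa> * cdot z x)) \<le> K"
    "\<And>x v. norm x \<le> r \<Longrightarrow> cmod (\<kappa> * cdot v x * exp (\<kappa> * cdot z x)) \<le> K * norm v"
    "\<And>x v. norm x \<le> r \<Longrightarrow> norm v \<le> 1 \<Longrightarrow>
      cmod (exp (\<kappa> * cdot (z + v) x) - exp (\<kappa> * cdot z x) - \<kappa> * cdot v x * exp (\<kappa> * cdot z x))
        \<le> K * (norm v)\<^sup>2"
proof -
  define \<rho> where "\<rho> = cmod \<kappa> * real CARD('n) * r"
  have \<rho>: "\<rho> \<ge> 0" using r by (simp add: \<rho>_def)
  have lin: "cmod (\<kappa> * cdot v x) \<le> \<rho> * norm v" if "norm x \<le> r"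
    for v :: "complex ^ 'n" and x
  proof -
    have "cmod (\<kappa> * cdot v x) \<le> cmod \<kappa> * (real CARD('n) * norm v * norm x)"
      unfolding norm_mult by (intro mult_left_mono norm_cdot_le) simp
    also have "\<dots> \<le> cmod \<kappa> * (real CARD('n) * norm v * r)"
      using that by (intro mult_left_mono) auto
    finally show ?thesis by (simp add: \<rho>_def mult_ac)
  qed
  define K where "K = exp (\<rho> * norm z) * (1 + \<rho> + exp \<rho> * \<rho>\<^sup>2)"
  have ez: "cmod (exp (\<kappa> * cdot z x)) \<le> exp (\<rho> * norm z)" if "norm x \<le> r" for x
    using order_trans[OF norm_exp] lin[OF that, of z] by force
  have K: "exp (\<rho> * norm z) * 1 \<le> K" "exp (\<rho> * norm z) * \<rho> \<le> K"
    "exp (\<rho> * norm z) * (exp \<rho> * \<rho>\<^sup>2) \<le> K"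
    unfolding K_def using \<rho> by (intro mult_left_mono; simp)+
  show thesis
  proof (rule that[of K])
    show "0 \<le> K" unfolding K_def using \<rho> by simp
  next
    fix x :: "real ^ 'n" assume x: "norm x \<le> r"
    show "cmod (exp (\<kappa> * cdot z x)) \<le> K" 
      by (rule order_trans[OF ez[OF x]]) (use K(1) in simp)
  next
    fix x :: "real ^ 'n" and v :: "complex ^ 'n" assume x: "norm x \<le> r"
    have "cmod (\<kappa> * cdot v x * exp (\<kappa> * cdot z x)) \<le> (\<rho> * norm v) * exp (\<rho> * norm z)"
      unfolding norm_mult[of _ "exp _"] using lin[OF x] ez[OF x] \<rho> by (intro mult_mono) auto
    also have "\<dots> = (exp (\<rho> * norm z) * \<rho>) * norm v" by simp
    also have "\<dots> \<le> K * norm v"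
      using K(2) by (intro mult_right_mono) auto
    finally show "cmod (\<kappa> * cdot v x * exp (\<kappa> * cdot z x)) \<le> K * norm v" .
  next
    fix x :: "real ^ 'n" and v :: "complex ^ 'n" assume x: "norm x \<le> r" and v: "norm v \<le> 1"
    define w where "w = \<kappa> * cdot v x"
    have w: "cmod w \<le> \<rho> * norm v" unfolding w_def by (rule lin[OF x])
    also have "\<dots> \<le> \<rho>" using \<rho> v by (simp add: mult_left_le)
    finally have w': "cmod w \<le> \<rho>" .
    have "cmod (exp w - 1 - w) \<le> exp (cmod w) * (cmod w)\<^sup>2"
      using Taylor_exp_field[of w 1] by (simp add: power2_eq_square algebra_simps)
    also have "\<dots> \<le> exp \<rho> * (\<rho> * norm v)\<^sup>2"
      using w w' by (intro mult_mono power_mono) auto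
    finally have R: "cmod (exp w - 1 - w) \<le> exp \<rho> * (\<rho> * norm v)\<^sup>2" .
    have "exp (\<kappa> * cdot (z + v) x) - exp (\<kappa> * cdot z x) - \<kappa> * cdot v x * exp (\<kappa> * cdot z x)
        = exp (\<kappa> * cdot z x) * (exp w - 1 - w)"
      by (simp add: w_def cdot_add ring_distribs exp_add)
    also have "cmod \<dots> \<le> exp (\<rho> * norm z) * (exp \<rho> * (\<rho> * norm v)\<^sup>2)"
      unfolding norm_mult using R ez[OF x] by (intro mult_mono) auto
    also have "\<dots> = (exp (\<rho> * norm z) * (exp \<rho> * \<rho>\<^sup>2)) * (norm v)\<^sup>2"
      by (simp add: power_mult_distrib)
    also have "\<dots> \<le> K * (norm v)\<^sup>2"
      using K(3) by (intro mult_right_mono) auto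
    finally show "cmod (exp (\<kappa> * cdot (z + v) x) - exp (\<kappa> * cdot z x)
      - \<kappa> * cdot v x * exp (\<kappa> * cdot z x)) \<le> K * (norm v)\<^sup>2" .
  qed
qed

section \<open>Spectral sums of orthogonal frequency sets\<close>

lemma integrable_continuous_bounded_support:
  fixes g :: "real ^ 'n \<Rightarrow> complex"
  assumes "prob_space M" "sets M = sets borel" and r: "AE x in M. norm x \<le> r"
    and g: "continuous_on UNIV g"
  shows "integrable M g"
proof -
  interpret prob_space M by fact
  have "compact (g ` cball 0 r)"
    using g by (intro compact_continuous_image) (auto intro: continuous_on_subset)
  then obtain B where "\<And>x. norm x \<le> r \<Longrightarrow> cmod (g x) \<le> B"
    using compact_imp_bounded by (force simp: bounded_iff)
  then have "AE x in M. cmod (g x) \<le> B" using r by (auto elim: eventually_mono)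
  moreover have "g \<in> borel_measurable M"
    using borel_measurable_continuous_onI[OF g] by (simp add: measurable_cong_sets[OF assms(2) refl])
  ultimately show ?thesis by (rule integrable_const_bound)
qed

lemma l2_le_sum_squares: "l2_le I a C \<Longrightarrow> finite F \<Longrightarrow> F \<subseteq> I \<Longrightarrow> (\<Sum>i\<in>F. (cmod (a i))\<^sup>2) \<le> C\<^sup>2"
  unfolding l2_le_def L2_set_def by (blast intro: sqrt_le_D)

lemma fourier_minus: "fourier M (- t) = cnj (fourier M t)"
  unfolding fourier_def by (subst Bochner_Integration.integral_cnj[symmetric]) (simp add: exp_cnj)

text \<open>The extension of the spectral sum is the sum of \<open>a 1 z \<gamma> * a (- 1) z \<gamma>\<close> over \<open>\<gamma>\<close>, where \<open>a s z \<gamma>\<close> is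
  the integral of \<open>exp (2 \<pi> i s ((z + \<gamma>) \<cdot> x))\<close>. For real \<open>z\<close> the two factors are conjugate to each other.
  For each fixed sign \<open>s\<close>, the \<open>a s z \<gamma>\<close> are coefficients of a bounded function with respect to an
  orthonormal family, so Bessel's inequality turns uniform bounds on functions into \<open>\<ell>\<^sup>2\<close> bounds on
  coefficients.\<close>

lemma spectral_sum_orthogonal:
  fixes M :: "(real ^ 'n) measure" and \<Gamma> :: "(real ^ 'n) set"
  assumes M: "prob_space M" "sets M = sets borel" and r: "AE x in M. norm x \<le> r" and r0: "0 \<le> r"
    and orth: "\<And>\<gamma> \<gamma>'. \<gamma> \<in> \<Gamma> \<Longrightarrow> \<gamma>' \<in> \<Gamma> \<Longrightarrow> \<gamma> \<noteq> \<gamma>' \<Longrightarrow> fourier M (\<gamma> - \<gamma>') = 0"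
  shows "(\<lambda>\<gamma>. (cmod (fourier M (t + \<gamma>)))\<^sup>2) summable_on \<Gamma>"
    and "spectral_sum M \<Gamma> t \<le> 1"
    and "has_entire_extension (spectral_sum M \<Gamma>)"
proof -
  interpret prob_space M by fact
  define e where "e t x = exp (2 * complex_of_real pi * \<i> * complex_of_real (t \<bullet> x))" for t x :: "real ^ 'n"
  define cf where "cf s g \<gamma> = (\<integral>x. g x * e (s *\<^sub>R \<gamma>) x \<partial>M)" for s g \<gamma>
  have e_cont [continuous_intros]: "continuous_on S (e t)" for S t
    unfolding e_def by (intro continuous_intros)
  have meas: "g \<in> borel_measurable M" if "continuous_on UNIV g" for g :: "real ^ 'n \<Rightarrow> complex"
    using borel_measurable_continuous_onI[OF that] by (simp add: measurable_cong_sets[OF M(2) refl])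
  have int: "integrable M (\<lambda>x. g x * e t x)" if "continuous_on UNIV g" for g t
    using that by (intro integrable_continuous_bounded_support[OF M r] continuous_intros)
  have bessel: "l2_le \<Gamma> (cf s g) C"
    if s: "s \<in> {1, -1}" and g: "continuous_on UNIV g" and C: "0 \<le> C" "\<And>x. norm x \<le> r \<Longrightarrow> cmod (g x) \<le> C"
    for s g C
    unfolding l2_le_def L2_set_def
  proof (intro allI impI)
    fix F assume F: "finite F" "F \<subseteq> \<Gamma>"
    have "(\<Sum>\<gamma>\<in>F. (cmod (\<integral>x. g x * e (s *\<^sub>R \<gamma>) x \<partial>M))\<^sup>2) \<le> C\<^sup>2"
    proof (rule bessel_inequality[OF M(1) F(1)])
      show "e (s *\<^sub>R \<gamma>) \<in> borel_measurable M" for \<gamma> by (intro meas continuous_intros)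
      show "g \<in> borel_measurable M" by (intro meas g)
      show "cmod (e (s *\<^sub>R \<gamma>) x) = 1" for \<gamma> x by (simp add: e_def)
      show "AE x in M. cmod (g x) \<le> C" using r C(2) by (auto elim: eventually_mono)
      show "(\<integral>x. e (s *\<^sub>R \<gamma>) x * cnj (e (s *\<^sub>R \<gamma>') x) \<partial>M) = 0"
        if "\<gamma> \<in> F" "\<gamma>' \<in> F" "\<gamma> \<noteq> \<gamma>'" for \<gamma> \<gamma>'
      proof -
        have "e (s *\<^sub>R \<gamma>) x * cnj (e (s *\<^sub>R \<gamma>') x) = e (s *\<^sub>R (\<gamma> - \<gamma>')) x" for x
          by (simp add: e_def exp_cnj inner_diff_left ring_distribs scaleR_diff_right flip: exp_add)
        then have "(\<integral>x. e (s *\<^sub>R \<gamma>) x * cnj (e (s *\<^sub>R \<gamma>') x) \<partial>M) = fourier M (s *\<^sub>R (\<gamma> - \<gamma>'))"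
          by (simp add: fourier_def e_def)
        \<comment> \<open>The sign \<open>s = - 1\<close> exchanges the roles of \<open>\<gamma>\<close> and \<open>\<gamma>'\<close>.\<close>
        then show ?thesis
          using s that orth[of \<gamma> \<gamma>'] orth[of \<gamma>' \<gamma>] subsetD[OF F(2)] by auto
      qed
    qed
    then show "sqrt (\<Sum>\<gamma>\<in>F. (cmod (cf s g \<gamma>))\<^sup>2) \<le> C"
      unfolding cf_def using C(1) by (intro real_le_lsqrt) (auto intro: sum_nonneg)
  qed
  have l2: "l2_le \<Gamma> (\<lambda>\<gamma>. fourier M (t + \<gamma>)) 1" for t
  proof -
    have "fourier M (t + \<gamma>) = cf 1 (e t) \<gamma>" for \<gamma>
      by (simp add: fourier_def cf_def e_def inner_add_left ring_distribs exp_add)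
    moreover have "l2_le \<Gamma> (cf 1 (e t)) 1"
      by (intro bessel e_cont) (simp_all add: e_def)
    ultimately show ?thesis by simp
  qed
  show sum: "(\<lambda>\<gamma>. (cmod (fourier M (t + \<gamma>)))\<^sup>2) summable_on \<Gamma>" for t
    using l2_le_mult(1)[OF l2[of t] l2[of t]] by (simp add: norm_mult power2_eq_square)
  show "spectral_sum M \<Gamma> t \<le> 1"
    unfolding spectral_sum_def
    using l2_le_sum_squares[OF l2[of t]] by (intro infsum_le_finite_sums[OF sum]) simp

  define \<kappa> where "\<kappa> s = 2 * complex_of_real pi * \<i> * complex_of_real s" for s
  define a where "a s z = cf s (\<lambda>x. exp (\<kappa> s * cdot z x))" for s z
  define a' where "a' s z v = cf s (\<lambda>x. \<kappa> s * cdot v x * exp (\<kappa> s * cdot z x))" for s z v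
  have real_val: "a 1 (cvec t) \<gamma> * a (- 1) (cvec t) \<gamma>
      = complex_of_real ((cmod (fourier M (t + \<gamma>)))\<^sup>2)" for t \<gamma>
  proof -
    have "a s (cvec t) \<gamma> = fourier M (s *\<^sub>R (t + \<gamma>))" for s
      by (simp add: a_def cf_def cdot_cvec fourier_def e_def \<kappa>_def scaleR_add_right
          inner_add_left ring_distribs exp_add mult_ac)
    moreover have "fourier M (- (t + \<gamma>)) = cnj (fourier M (t + \<gamma>))"
      by (rule fourier_minus)
    ultimately show ?thesis by (simp add: complex_norm_square del: of_real_power minus_add_distrib)
  qed
  define F where "F z = (\<Sum>\<^sub>\<infinity>\<gamma>\<in>\<Gamma>. a 1 z \<gamma> * a (- 1) z \<gamma>)" for z
  have "F (\<chi> i. complex_of_real (t $ i)) = complex_of_real (spectral_sum M \<Gamma> t)" for t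
  proof -
    have "((\<lambda>\<gamma>. (cmod (fourier M (t + \<gamma>)))\<^sup>2) has_sum spectral_sum M \<Gamma> t) \<Gamma>"
      unfolding spectral_sum_def by (rule has_sum_infsum[OF sum])
    then have "((\<lambda>\<gamma>. a 1 (cvec t) \<gamma> * a (- 1) (cvec t) \<gamma>) has_sum complex_of_real (spectral_sum M \<Gamma> t)) \<Gamma>"
      unfolding real_val by (rule has_sum_of_real)
    then show ?thesis unfolding F_def cvec_def[symmetric] by (rule infsumI)
  qed
  moreover have "entire F"
    unfolding entire_def
  proof
    fix z :: "complex ^ 'n"
    have "\<exists>K. 0 \<le> K \<and> l2_le \<Gamma> (a s z) K \<and> (\<forall>v. l2_le \<Gamma> (a' s z v) (K * norm v)) \<and>
        (\<forall>v. norm v \<le> 1 \<longrightarrow> l2_le \<Gamma> (\<lambda>\<gamma>. a s (z + v) \<gamma> - a s z \<gamma> - a' s z v \<gamma>) (K * (norm v)\<^sup>2))"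
      if s: "s \<in> {1, -1}" for s
    proof -
      obtain K where K0: "0 \<le> K" and K: "\<And>x. norm x \<le> r \<Longrightarrow> cmod (exp (\<kappa> s * cdot z x)) \<le> K"
        "\<And>x v. norm x \<le> r \<Longrightarrow> cmod (\<kappa> s * cdot v x * exp (\<kappa> s * cdot z x)) \<le> K * norm v"
        "\<And>x v. norm x \<le> r \<Longrightarrow> norm v \<le> 1 \<Longrightarrow> cmod (exp (\<kappa> s * cdot (z + v) x) - exp (\<kappa> s * cdot z x)
            - \<kappa> s * cdot v x * exp (\<kappa> s * cdot z x)) \<le> K * (norm v)\<^sup>2"
        by (rule exp_cdot_bounds[OF r0, of "\<kappa> s" z]) blast
      have i1: "integrable M (\<lambda>x. exp (\<kappa> s * cdot w x) * e (s *\<^sub>R \<gamma>) x)" for w \<gamma>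
        by (intro int continuous_intros)
      have i2: "integrable M (\<lambda>x. \<kappa> s * cdot v x * exp (\<kappa> s * cdot z x) * e (s *\<^sub>R \<gamma>) x)" for v \<gamma>
        by (intro int continuous_intros)
      have rem: "(\<lambda>\<gamma>. a s (z + v) \<gamma> - a s z \<gamma> - a' s z v \<gamma>)
          = cf s (\<lambda>x. exp (\<kappa> s * cdot (z + v) x) - exp (\<kappa> s * cdot z x)
              - \<kappa> s * cdot v x * exp (\<kappa> s * cdot z x))" for v
        unfolding a_def a'_def cf_def left_diff_distrib
        by (simp only: i1 i2 Bochner_Integration.integral_diff Bochner_Integration.integrable_diff)
      have "l2_le \<Gamma> (a s z) K"
        unfolding a_def using K(1) K0 by (intro bessel[OF s] continuous_intros)
      moreover have "l2_le \<Gamma> (a' s z v) (K * norm v)" for v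
        unfolding a'_def using K(2) K0 by (intro bessel[OF s] continuous_intros) auto
      moreover have "l2_le \<Gamma> (\<lambda>\<gamma>. a s (z + v) \<gamma> - a s z \<gamma> - a' s z v \<gamma>) (K * (norm v)\<^sup>2)"
        if "norm v \<le> 1" for v
        unfolding rem using K(3)[OF _ that] K0 by (intro bessel[OF s] continuous_intros) auto
      ultimately show ?thesis using K0 by blast
    qed
    from this[of 1] this[of "- 1"] obtain K1 K2
      where K1: "0 \<le> K1" "l2_le \<Gamma> (a 1 z) K1" "\<And>v. l2_le \<Gamma> (a' 1 z v) (K1 * norm v)"
        "\<And>v. norm v \<le> 1 \<Longrightarrow> l2_le \<Gamma> (\<lambda>\<gamma>. a 1 (z + v) \<gamma> - a 1 z \<gamma> - a' 1 z v \<gamma>) (K1 * (norm v)\<^sup>2)"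
      and K2: "0 \<le> K2" "l2_le \<Gamma> (a (- 1) z) K2" "\<And>v. l2_le \<Gamma> (a' (- 1) z v) (K2 * norm v)"
        "\<And>v. norm v \<le> 1 \<Longrightarrow> l2_le \<Gamma> (\<lambda>\<gamma>. a (- 1) (z + v) \<gamma> - a (- 1) z \<gamma> - a' (- 1) z v \<gamma>) (K2 * (norm v)\<^sup>2)"
      by auto
    have add: "a' s z (u + v) \<gamma> = a' s z u \<gamma> + a' s z v \<gamma>" for s u v \<gamma>
      unfolding a'_def cf_def cdot_add ring_distribs
      by (intro Bochner_Integration.integral_add int continuous_intros)
    have smult: "a' s z (c *s v) \<gamma> = c * a' s z v \<gamma>" for s c v \<gamma>
      by (simp add: a'_def cf_def cdot_smult mult_ac flip: integral_mult_right_zero)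
    show "\<exists>D. (F has_derivative D) (at z) \<and> (\<forall>c v. D (c *s v) = c * D v)"
      unfolding F_def
    proof (rule complex_derivative_infsum_mult)
      show "l2_le \<Gamma> (a 1 z) (K1 + K2)" "l2_le \<Gamma> (a (- 1) z) (K1 + K2)"
        using K1(1,2) K2(1,2) by (auto elim: l2_le_mono)
      show "l2_le \<Gamma> (a' 1 z v) ((K1 + K2) * norm v)" "l2_le \<Gamma> (a' (- 1) z v) ((K1 + K2) * norm v)" for v
        using K1(1) K2(1) by (auto intro!: l2_le_mono[OF K1(3)] l2_le_mono[OF K2(3)] mult_right_mono)
      show "l2_le \<Gamma> (\<lambda>\<gamma>. a 1 (z + v) \<gamma> - a 1 z \<gamma> - a' 1 z v \<gamma>) ((K1 + K2) * (norm v)\<^sup>2)"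
        "l2_le \<Gamma> (\<lambda>\<gamma>. a (- 1) (z + v) \<gamma> - a (- 1) z \<gamma> - a' (- 1) z v \<gamma>) ((K1 + K2) * (norm v)\<^sup>2)"
        if "norm v \<le> 1" for v
        using K1(1) K2(1)
        by (auto intro!: l2_le_mono[OF K1(4)[OF that]] l2_le_mono[OF K2(4)[OF that]] mult_right_mono)
    qed (simp_all add: add smult)
  qed
  ultimately show "has_entire_extension (spectral_sum M \<Gamma>)"
    unfolding has_entire_extension_def by blast
qed

section \<open>Duality of Hadamard systems\<close>

lemma cmat_eigenvalue_iff_det:
  fixes A :: "complex ^ 'n ^ 'n"
  shows "cmat_eigenvalue A c \<longleftrightarrow> det (A - mat c) = 0"
proof -
  have "mat c *v v = c *s v" for v :: "complex ^ 'n"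
    by (simp add: vec_eq_iff matrix_vector_mult_def mat_def if_distrib[of "\<lambda>x. x * _"] cong: if_cong)
  then have "cmat_eigenvalue A c \<longleftrightarrow> (\<exists>v. v \<noteq> 0 \<and> (A - mat c) *v v = 0)"
    by (simp add: cmat_eigenvalue_def matrix_vector_mult_diff_rdistrib)
  also have "\<dots> \<longleftrightarrow> \<not> invertible (A - mat c)"
    by (auto simp: invertible_left_inverse matrix_left_invertible_ker)
  finally show ?thesis by (simp add: invertible_det_nz)
qed

lemma expansive_transpose:
  assumes "expansive R"
  shows "expansive (transpose R)"
proof -
  have "map_matrix complex_of_real (transpose R) - mat c = transpose (map_matrix complex_of_real R - mat c)" for c
    by (auto simp: vec_eq_iff transpose_def mat_def)
  then show ?thesis
    using assms by (simp add: expansive_def cmat_eigenvalue_iff_det)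
qed

lemma matrix_inv_transpose:
  fixes A :: "real ^ 'n ^ 'n"
  assumes "invertible A"
  shows "matrix_inv (transpose A) = transpose (matrix_inv A)"
proof -
  have 1: "transpose (matrix_inv A) ** transpose A = mat 1"
    using assms by (simp add: matrix_inv_right transpose_mat flip: matrix_transpose_mul)
  have "transpose A ** matrix_inv (transpose A) = mat 1"
    using assms by (intro matrix_inv_right) (simp add: invertible_det_nz)
  then show ?thesis by (metis 1 matrix_mul_assoc matrix_mul_lid matrix_mul_rid)
qed

lemma unitary_on_transpose:
  assumes "unitary_on I J U"
  shows "unitary_on J I (\<lambda>j i. U i j)"
proof -
  have "(\<Sum>i\<in>I. U i j * cnj (U i j')) = (if j = j' then 1 else 0)" if "j \<in> J" "j' \<in> J" for j j'
  proof -
    have "(\<Sum>i\<in>I. U i j * cnj (U i j')) = (\<Sum>i\<in>I. cnj (U i j') * U i j)"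
      by (simp add: mult.commute)
    then show ?thesis using assms that by (auto simp: unitary_on_def)
  qed
  moreover have "(\<Sum>j\<in>J. cnj (U i j) * U i' j) = (if i = i' then 1 else 0)" if "i \<in> I" "i' \<in> I" for i i'
  proof -
    have "(\<Sum>j\<in>J. cnj (U i j) * U i' j) = (\<Sum>j\<in>J. U i' j * cnj (U i j))"
      by (simp add: mult.commute)
    then show ?thesis using assms that by (auto simp: unitary_on_def)
  qed
  ultimately show ?thesis by (simp add: unitary_on_def)
qed

lemma hadamard_system_transpose:
  assumes H: "hadamard_system R B L"
  shows "hadamard_system (transpose R) L B"
proof -
  let ?U = "\<lambda>b l. exp (2 * complex_of_real pi * \<i> * complex_of_real ((matrix_inv R *v b) \<bullet> l))
                             / complex_of_real (sqrt (real (card B)))"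
  have inv: "invertible R" using H expansive_invertible by (auto simp: hadamard_system_def)
  have phase: "(matrix_inv (transpose R) *v l) \<bullet> b = (matrix_inv R *v b) \<bullet> l" for b l
    unfolding matrix_inv_transpose[OF inv] by (metis inner_commute inner_matrix_vector_mult)
  have U: "unitary_on B L ?U" and card: "card B = card L"
    using H by (auto simp: hadamard_system_def)
  have "unitary_on L B (\<lambda>l b. ?U b l)"
    using U by (rule unitary_on_transpose)
  then have "unitary_on L B (\<lambda>l b. exp (2 * complex_of_real pi * \<i> *
      complex_of_real ((matrix_inv (transpose R) *v l) \<bullet> b)) / complex_of_real (sqrt (real (card L))))"
    unfolding phase card .
  moreover have "transpose R $ i $ j \<in> \<int>" for i j
    using H by (simp add: hadamard_system_def transpose_def)
  ultimately show ?thesis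
    using H expansive_transpose[of R]
    by (simp add: hadamard_system_def funpow_transpose_inner del: transpose_matrix_vector)
qed

lemma hadamard_system_spectral_sum:
  assumes H: "hadamard_system A D L" and inv: "invariant_measure A D M"
  shows "(\<lambda>\<gamma>. (cmod (fourier M (t + \<gamma>)))\<^sup>2) summable_on digit_sums (transpose A) L"
    and "spectral_sum M (digit_sums (transpose A) L) t \<le> 1"
    and "has_entire_extension (spectral_sum M (digit_sums (transpose A) L))"
proof -
  have "finite D" "D \<noteq> {}" "expansive A" using H by (auto simp: hadamard_system_def)
  then obtain r where "AE x in M. norm x \<le> r" "0 \<le> r"
    using invariant_measure_bounded_support[OF inv] expansive_inverse_powers_tendsto_0 by metis
  note * = spectral_sum_orthogonal[OF invariant_measureD(1,2)[OF inv] this hadamard_system_orthogonal[OF H inv]]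
  show "(\<lambda>\<gamma>. (cmod (fourier M (t + \<gamma>)))\<^sup>2) summable_on digit_sums (transpose A) L"
    and "spectral_sum M (digit_sums (transpose A) L) t \<le> 1"
    and "has_entire_extension (spectral_sum M (digit_sums (transpose A) L))"
    by (rule *; assumption)+
qed

theorem corollary2p8:
  fixes R :: "real ^ 'n ^ 'n"
    and B L :: "(real ^ 'n) set"
    and muB muL :: "(real ^ 'n) measure"
  assumes "hadamard_system R B L"
    and "invariant_measure R B muB"
    and "invariant_measure (transpose R) L muL"
  shows "(\<forall>t. (\<lambda>\<gamma>. (cmod (fourier muB (t + \<gamma>)))\<^sup>2) summable_on digit_sums (transpose R) L)
       \<and> (\<forall>t. (\<lambda>\<xi>. (cmod (fourier muL (t + \<xi>)))\<^sup>2) summable_on digit_sums R B)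
       \<and> has_entire_extension (spectral_sum muB (digit_sums (transpose R) L))
       \<and> has_entire_extension (spectral_sum muL (digit_sums R B))
       \<and> (\<forall>t. spectral_sum muB (digit_sums (transpose R) L) t \<le> 1)
       \<and> (\<forall>t. spectral_sum muL (digit_sums R B) t \<le> 1)"
  using hadamard_system_spectral_sum[OF assms(1,2)]
    hadamard_system_spectral_sum[OF hadamard_system_transpose[OF assms(1)] assms(3)]
  by (simp add: transpose_transpose)

end
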